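(* Let $V=\{v_1,\dots,v_N\}$ be a collection of vectors spanning an $n$-dimensional complex vector space $E$, with the linear order $v_1<v_2<\cdots<v_N$, and let $\mathcal C_V=\bigoplus_{k\ge0}\mathcal C_V^k$ be the associated graded algebra. Then the dimension of $\mathcal C_V$ is equal to the number $\mathrm{ind}(V)$ of independent subsets in $V$. Moreover, for every $k$, the dimension of the $k$-th component $\mathcal C_V^k$ is equal to the number of independent subsets $S\subset V$ such that $k=N-|S|-\mathrm{act}(S)$.
   Context: $V$ is a collection (family) of vectors indexed by $\{1,\dots,N\}$; subsets of $V$ correspond to subsets of the index set. A subset of $V$ is independent if it is linearly independent in $E$ (the empty subset is independent); $\mathrm{ind}(V)$ is the number of independent subsets. A cycle is a minimal by inclusion non-independent subset. For an independent subset $S$, a vector $v\in V\setminus S$ is externally active if $S\cup\{v\}$ contains a cycle $C$ such that $v$ is the minimal element of $C$ in the order $v_1<\cdots<v_N$; $\mathrm{act}(S)$ is the number of externally active vectors with respect to $S$. The algebra $\mathcal C_V$: let $F=\mathbb C^N$ with distinguished basis $\phi^1,\dots,\phi^N$, let $p:F\to E$ be the linear map with $p(\phi^i)=v_i$, and $p^*:E^*\to F^*$ the dual map, with image $P=\mathrm{Im}(p^* )$. Let $\phi_1,\dots,\phi_N$ be the dual basis of $F^*$ and $\Phi_N=\mathrm{Sym}(F^* )/\langle\phi_i^2,\ i=1,\dots,N\rangle$. Then $\mathcal C_V$ is the (unital) subalgebra of $\Phi_N$ generated by the elements of $P$, i.e. the image of the induced map $\mathrm{Sym}(E^* )\to\Phi_N$;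 it is graded by degree. *)

theory Defs
  imports
    Complex_Main
    "HOL-Library.Poly_Mapping"
    "HOL-Algebra.QuotRing"
    "HOL-Algebra.Generated_Rings"
    "HOL-Algebra.Embedded_Algebras"
begin

section \<open>Independent subsets and external activity\<close>

text \<open>
  A collection of vectors is a family \<open>v\<close> indexed by \<open>{1..N}\<close>, possibly with repetitions, and its
  subsets are sets of indices. Hence independence of \<open>S\<close> also demands that \<open>v\<close> be injective on \<open>S\<close>.
  The order on the collection is the order of the indices.
\<close>

definition indep_subset ::
  "(complex \<Rightarrow> 'e \<Rightarrow> 'e) \<Rightarrow> nat \<Rightarrow> (nat \<Rightarrow> 'e::ab_group_add) \<Rightarrow> nat set \<Rightarrow> bool" where
  "indep_subset scale N v S \<longleftrightarrow>
     S \<subseteq> {1..N} \<and> inj_on v S \<and> \<not> module.dependent scale (v ` S)"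

definition is_cycle ::
  "(complex \<Rightarrow> 'e \<Rightarrow> 'e) \<Rightarrow> nat \<Rightarrow> (nat \<Rightarrow> 'e::ab_group_add) \<Rightarrow> nat set \<Rightarrow> bool" where
  "is_cycle scale N v C \<longleftrightarrow>
     C \<subseteq> {1..N} \<and> \<not> indep_subset scale N v C \<and> (\<forall>D. D \<subset> C \<longrightarrow> indep_subset scale N v D)"

definition ext_active ::
  "(complex \<Rightarrow> 'e \<Rightarrow> 'e) \<Rightarrow> nat \<Rightarrow> (nat \<Rightarrow> 'e::ab_group_add) \<Rightarrow> nat set \<Rightarrow> nat \<Rightarrow> bool" where
  "ext_active scale N v S i \<longleftrightarrow>
     i \<in> {1..N} - S \<and>
     (\<exists>C. C \<subseteq> S \<union> {i} \<and> is_cycle scale N v C \<and> i \<in> C \<and> (\<forall>j\<in>C. i \<le> j))"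

definition act ::
  "(complex \<Rightarrow> 'e \<Rightarrow> 'e) \<Rightarrow> nat \<Rightarrow> (nat \<Rightarrow> 'e::ab_group_add) \<Rightarrow> nat set \<Rightarrow> nat" where
  "act scale N v S = card {i. ext_active scale N v S i}"

definition ind ::
  "(complex \<Rightarrow> 'e \<Rightarrow> 'e) \<Rightarrow> nat \<Rightarrow> (nat \<Rightarrow> 'e::ab_group_add) \<Rightarrow> nat" where
  "ind scale N v = card {S. indep_subset scale N v S}"


section \<open>The symmetric algebra of the dual of \<open>F\<close>\<close>

text \<open>
  With \<open>\<phi>\<^sub>1, \<dots>, \<phi>\<^sub>N\<close> the dual basis of \<open>F\<^sup>*\<close>, the algebra \<open>Sym(F\<^sup>*)\<close> is the polynomial ring
  \<open>\<complex>[\<phi>\<^sub>1, \<dots>, \<phi>\<^sub>N]\<close>. A polynomial maps monomials (finitely supported exponent functions) to their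
  coefficients; multiplication in the type below is convolution. The type has a variable for
  every natural number, so the carrier restricts to those with index in \<open>{1..N}\<close>.
\<close>

type_synonym cpoly = "(nat \<Rightarrow>\<^sub>0 nat) \<Rightarrow>\<^sub>0 complex"

definition cconst :: "complex \<Rightarrow> cpoly" where
  "cconst c = Poly_Mapping.single 0 c"

definition phi :: "nat \<Rightarrow> cpoly" where
  "phi i = Poly_Mapping.single (Poly_Mapping.single i 1) 1"

definition sym_alg :: "nat \<Rightarrow> cpoly ring" where
  "sym_alg N =
     \<lparr>carrier = {p. \<forall>m \<in> Poly_Mapping.keys p. Poly_Mapping.keys m \<subseteq> {1..N}},
      mult = (*), one = 1, zero = 0, add = (+)\<rparr>"

definition homogeneous :: "nat \<Rightarrow> cpoly \<Rightarrow> bool" where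
  "homogeneous k p \<longleftrightarrow>
     (\<forall>m \<in> Poly_Mapping.keys p. (\<Sum>i \<in> Poly_Mapping.keys m. Poly_Mapping.lookup m i) = k)"


section \<open>The algebras \<open>\<Phi>\<^sub>N\<close> and \<open>\<C>\<^sub>V\<close>\<close>

definition sq_ideal :: "nat \<Rightarrow> cpoly set" where
  "sq_ideal N = Idl\<^bsub>sym_alg N\<^esub> {phi i ^ 2 | i. i \<in> {1..N}}"

definition Phi :: "nat \<Rightarrow> cpoly set ring" where
  "Phi N = sym_alg N Quot sq_ideal N"

definition Phi_class :: "nat \<Rightarrow> cpoly \<Rightarrow> cpoly set" where
  "Phi_class N p = sq_ideal N +>\<^bsub>sym_alg N\<^esub> p"

text \<open>The ground field \<open>\<complex>\<close> inside \<open>\<Phi>\<^sub>N\<close>; dimensions are taken over this subfield.\<close>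

definition Phi_scalars :: "nat \<Rightarrow> cpoly set set" where
  "Phi_scalars N = range (\<lambda>c. Phi_class N (cconst c))"

definition Phi_comp :: "nat \<Rightarrow> nat \<Rightarrow> cpoly set set" where
  "Phi_comp N k = Phi_class N ` {p \<in> carrier (sym_alg N). homogeneous k p}"

text \<open>
  For \<open>l \<in> E\<^sup>*\<close> the functional \<open>p\<^sup>*(l) = l \<circ> p\<close> takes the value \<open>l (v i)\<close> on the \<open>i\<close>-th basis vector
  of \<open>F\<close>, so its expansion in the dual basis is \<open>\<Sum>i. l (v i) \<phi>\<^sub>i\<close>.
\<close>

definition p_star :: "nat \<Rightarrow> (nat \<Rightarrow> 'e) \<Rightarrow> ('e \<Rightarrow> complex) \<Rightarrow> cpoly" where
  "p_star N v l = (\<Sum>i = 1..N. cconst (l (v i)) * phi i)"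

definition P_space ::
  "(complex \<Rightarrow> 'e \<Rightarrow> 'e) \<Rightarrow> nat \<Rightarrow> (nat \<Rightarrow> 'e::ab_group_add) \<Rightarrow> cpoly set" where
  "P_space scale N v = {p_star N v l | l. Vector_Spaces.linear scale (*) l}"

text \<open>
  The unital \<open>\<complex>\<close>-subalgebra generated by \<open>P\<close> is the subring generated by the scalars and \<open>P\<close>. Note that
  \<open>subalgebra\<close> in the library only means a linear subspace.
\<close>

definition C_alg ::
  "(complex \<Rightarrow> 'e \<Rightarrow> 'e) \<Rightarrow> nat \<Rightarrow> (nat \<Rightarrow> 'e::ab_group_add) \<Rightarrow> cpoly set set" where
  "C_alg scale N v =
     generate_ring (Phi N) (Phi_scalars N \<union> Phi_class N ` P_space scale N v)"

definition C_comp ::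
  "(complex \<Rightarrow> 'e \<Rightarrow> 'e) \<Rightarrow> nat \<Rightarrow> (nat \<Rightarrow> 'e::ab_group_add) \<Rightarrow> nat \<Rightarrow> cpoly set set" where
  "C_comp scale N v k = C_alg scale N v \<inter> Phi_comp N k"


section \<open>Well-formedness of the algebraic setting\<close>

text \<open>
  The library's dimension predicate is meaningful only for a subfield of a ring; the facts below
  show that \<open>Phi_scalars N\<close> and \<open>Phi N\<close> qualify.
\<close>

lemma sym_alg_simps [simp]:
  "p \<in> carrier (sym_alg N) \<longleftrightarrow> (\<forall>m \<in> Poly_Mapping.keys p. Poly_Mapping.keys m \<subseteq> {1..N})"
  "p \<otimes>\<^bsub>sym_alg N\<^esub> q = p * q" "p \<oplus>\<^bsub>sym_alg N\<^esub> q = p + q"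
  "\<one>\<^bsub>sym_alg N\<^esub> = 1" "\<zero>\<^bsub>sym_alg N\<^esub> = 0"
  by (simp_all add: sym_alg_def)

lemma sym_alg_closed:
  "p \<in> carrier (sym_alg N) \<Longrightarrow> q \<in> carrier (sym_alg N) \<Longrightarrow> p + q \<in> carrier (sym_alg N)"
  "p \<in> carrier (sym_alg N) \<Longrightarrow> q \<in> carrier (sym_alg N) \<Longrightarrow> p * q \<in> carrier (sym_alg N)"
  "p \<in> carrier (sym_alg N) \<Longrightarrow> - p \<in> carrier (sym_alg N)"
  "cconst c \<in> carrier (sym_alg N)"
  "i \<in> {1..N} \<Longrightarrow> phi i \<in> carrier (sym_alg N)"
proof -
  assume p: "p \<in> carrier (sym_alg N)"
  then show "- p \<in> carrier (sym_alg N)" by simp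
  assume q: "q \<in> carrier (sym_alg N)"
  show "p + q \<in> carrier (sym_alg N)"
    using p q Poly_Mapping.keys_add[of p q] unfolding sym_alg_simps by blast
  show "p * q \<in> carrier (sym_alg N)"
    unfolding sym_alg_simps
  proof
    fix m assume "m \<in> Poly_Mapping.keys (p * q)"
    then obtain a b
      where ab: "m = a + b" "a \<in> Poly_Mapping.keys p" "b \<in> Poly_Mapping.keys q"
      using keys_mult[of p q] by blast
    show "Poly_Mapping.keys m \<subseteq> {1..N}"
      using ab p q Poly_Mapping.keys_add[of a b] unfolding sym_alg_simps by blast
  qed
qed (simp_all add: cconst_def phi_def)

lemma sym_alg_cring: "cring (sym_alg N)"
proof (rule cringI)
  show "abelian_group (sym_alg N)"
  proof (rule abelian_groupI)
    fix p assume "p \<in> carrier (sym_alg N)"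
    then show "\<exists>q\<in>carrier (sym_alg N). q \<oplus>\<^bsub>sym_alg N\<^esub> p = \<zero>\<^bsub>sym_alg N\<^esub>"
      by (intro bexI[of _ "- p"]) simp_all
  qed (simp_all only: sym_alg_simps(2-5) sym_alg_closed ac_simps, simp_all)
  show "Group.comm_monoid (sym_alg N)"
    by (rule comm_monoidI)
      (simp_all only: sym_alg_simps(2-5) sym_alg_closed ac_simps, simp_all)
qed (simp only: sym_alg_simps(2-5) distrib_right)

lemma sq_generators_closed: "{phi i ^ 2 | i. i \<in> {1..N}} \<subseteq> carrier (sym_alg N)"
  using sym_alg_closed(2,5) unfolding power2_eq_square by blast

lemma sq_ideal_is_ideal: "ideal (sq_ideal N) (sym_alg N)"
  unfolding sq_ideal_def
  by (rule ring.genideal_ideal[OF cring.axioms(1)[OF sym_alg_cring] sq_generators_closed])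

lemma Phi_cring: "cring (Phi N)"
  unfolding Phi_def using sq_ideal_is_ideal sym_alg_cring by (rule ideal.quotient_is_cring)

lemma Phi_class_hom: "Phi_class N \<in> ring_hom (sym_alg N) (Phi N)"
  using ideal.rcos_ring_hom[OF sq_ideal_is_ideal] unfolding Phi_def Phi_class_def .

lemma lookup_mult_0:
  fixes p q :: cpoly
  shows "Poly_Mapping.lookup (p * q) 0 = Poly_Mapping.lookup p 0 * Poly_Mapping.lookup q 0"
proof -
  have eq: "(0 = l + m) \<longleftrightarrow> (l = 0 \<and> m = 0)" for l m :: "nat \<Rightarrow>\<^sub>0 nat"
    by (auto simp: poly_mapping_eq_iff fun_eq_iff lookup_add)
  have "(\<Sum>m. Poly_Mapping.lookup q m when 0 = l + m) = (Poly_Mapping.lookup q 0 when l = 0)"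
    for l :: "nat \<Rightarrow>\<^sub>0 nat"
    by (cases "l = 0") (simp_all add: eq)
  then show ?thesis
    by (simp add: lookup_mult mult_when)
qed

lemma one_notin_sq_ideal: "1 \<notin> sq_ideal N"
proof -
  interpret cring "sym_alg N" by (rule sym_alg_cring)
  define J where "J = {p \<in> carrier (sym_alg N). Poly_Mapping.lookup p 0 = 0}"
  have "ideal J (sym_alg N)"
  proof (rule idealI)
    show "subgroup J (add_monoid (sym_alg N))"
    proof (rule add.subgroupI)
      show "J \<subseteq> carrier (sym_alg N)" "J \<noteq> {}"
        unfolding J_def by auto (metis lookup_zero empty_iff keys_zero)
    next
      fix p assume p: "p \<in> J"
      then have "- p = \<ominus>\<^bsub>sym_alg N\<^esub> p"
        by (intro sum_zero_eq_neg) (auto simp: J_def simp del: sym_alg_simps(1) intro: sym_alg_closed)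
      then show "\<ominus>\<^bsub>sym_alg N\<^esub> p \<in> J"
        using p sym_alg_closed(3)[of p N] by (simp add: J_def flip: \<open>- p = _\<close>)
    next
      fix p q assume "p \<in> J" "q \<in> J"
      then show "p \<oplus>\<^bsub>sym_alg N\<^esub> q \<in> J"
        using sym_alg_closed(1)[of p N q] by (simp add: J_def lookup_add del: sym_alg_simps(1))
    qed
  qed (use sym_alg_closed(2)[of _ N] in
      \<open>auto simp: J_def lookup_mult_0 ring_axioms simp del: sym_alg_simps(1)\<close>)
  moreover have "{phi i ^ 2 | i. i \<in> {1..N}} \<subseteq> J"
  proof -
    have "Poly_Mapping.lookup (phi i ^ 2) 0 = 0" for i
      by (simp add: power2_eq_square lookup_mult_0 phi_def lookup_single
          poly_mapping_eq_iff fun_eq_iff when_def)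
    then show ?thesis using sq_generators_closed[of N] unfolding J_def by blast
  qed
  ultimately have "sq_ideal N \<subseteq> J"
    unfolding sq_ideal_def by (rule genideal_minimal)
  moreover have "1 \<notin> J" by (simp add: J_def)
  ultimately show ?thesis by blast
qed

lemma Phi_scalars_subfield: "subfield (Phi_scalars N) (Phi N)"
proof -
  interpret R: cring "sym_alg N" by (rule sym_alg_cring)
  interpret P: cring "Phi N" by (rule Phi_cring)
  interpret h: ring_hom_ring "sym_alg N" "Phi N" "Phi_class N"
    by (rule ring_hom_ringI2[OF R.ring_axioms P.ring_axioms Phi_class_hom])
  let ?k = "\<lambda>c. Phi_class N (cconst c)"
  note [simp del] = sym_alg_simps(1)
  note closed = sym_alg_closed(4)[of _ N]
  have k_in: "?k c \<in> carrier (Phi N)" for c using closed by (rule h.hom_closed)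
  have k_mult: "?k a \<otimes>\<^bsub>Phi N\<^esub> ?k b = ?k (a * b)" for a b
    using h.hom_mult[OF closed[of a] closed[of b]] by (simp add: cconst_def mult_single)
  have k_add: "?k a \<oplus>\<^bsub>Phi N\<^esub> ?k b = ?k (a + b)" for a b
    using h.hom_add[OF closed[of a] closed[of b]] by (simp add: cconst_def single_add)
  have k_one: "?k 1 = \<one>\<^bsub>Phi N\<^esub>" using h.hom_one by (simp add: cconst_def)
  have k_zero: "?k 0 = \<zero>\<^bsub>Phi N\<^esub>" using h.hom_zero by (simp add: cconst_def)
  have k_uminus: "\<ominus>\<^bsub>Phi N\<^esub> ?k a = ?k (- a)" for a
    using P.sum_zero_eq_neg[of "?k (- a)" "?k a"] k_in k_add k_zero by simp
  have nontrivial: "\<one>\<^bsub>Phi N\<^esub> \<noteq> \<zero>\<^bsub>Phi N\<^esub>"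
  proof
    assume "\<one>\<^bsub>Phi N\<^esub> = \<zero>\<^bsub>Phi N\<^esub>"
    then have "sq_ideal N +>\<^bsub>sym_alg N\<^esub> 1 = sq_ideal N"
      using h.hom_one by (simp add: Phi_class_def Phi_def FactRing_def)
    then have "1 \<in> sq_ideal N"
      using ideal.rcos_const_imp_mem[OF sq_ideal_is_ideal, of 1] R.one_closed by simp
    then show False using one_notin_sq_ideal by blast
  qed
  have sub: "subcring (Phi_scalars N) (Phi N)"
  proof (intro P.subcringI' P.subringI)
    show "Phi_scalars N \<subseteq> carrier (Phi N)" "\<one>\<^bsub>Phi N\<^esub> \<in> Phi_scalars N"
      using k_in k_one unfolding Phi_scalars_def by (blast, metis rangeI)
  qed (unfold Phi_scalars_def, use k_uminus k_mult k_add in auto)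
  have "x \<in> Units (Phi N\<lparr>carrier := Phi_scalars N\<rparr>)"
    if x: "x \<in> Phi_scalars N - {\<zero>\<^bsub>Phi N\<^esub>}" for x
  proof -
    obtain c where c: "x = ?k c" using x by (auto simp: Phi_scalars_def)
    then have "c \<noteq> 0" using x k_zero by auto
    then have "x \<otimes>\<^bsub>Phi N\<^esub> ?k (inverse c) = \<one>\<^bsub>Phi N\<^esub>" "?k (inverse c) \<otimes>\<^bsub>Phi N\<^esub> x = \<one>\<^bsub>Phi N\<^esub>"
      by (simp_all add: c k_mult k_one)
    then show ?thesis
      using x by (auto simp: Units_def Phi_scalars_def)
  qed
  moreover have "\<zero>\<^bsub>Phi N\<^esub> \<notin> Units (Phi N\<lparr>carrier := Phi_scalars N\<rparr>)"
    using nontrivial subcringE(1)[OF sub] by (auto simp: Units_def)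
  ultimately have "Units (Phi N\<lparr>carrier := Phi_scalars N\<rparr>) = Phi_scalars N - {\<zero>\<^bsub>Phi N\<^esub>}"
    by (auto simp: Units_def)
  then have "field (Phi N\<lparr>carrier := Phi_scalars N\<rparr>)"
    using P.subcring_iff[OF subcringE(1)[OF sub]] sub by (intro cring.cring_fieldI) simp_all
  then show ?thesis
    by (simp add: P.subfield_iff(1) subcringE(1)[OF sub])
qed

end

theory Submission
  imports Defs
begin

text \<open>
  For \<open>l \<in> E\<^sup>*\<close> put \<open>x\<^sub>i = l (v\<^sub>i)\<close>. Since \<open>\<Prod>(1 + x\<^sub>i \<phi>\<^sub>i) = exp (\<Sum> x\<^sub>i \<phi>\<^sub>i)\<close> in \<open>\<Phi>\<^sub>N\<close>, the algebra
  \<open>\<C>\<^sub>V\<close> is the span of the vectors \<open>(\<Prod>\<^bsub>i\<in>I\<^esub> x\<^sub>i)\<^sub>I\<close> of squarefree coefficients, \<open>l\<close> varying. Because row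
  rank is column rank, its dimension in degree \<open>k\<close> is that of the span of the functions
  \<open>l \<mapsto> \<Prod>\<^bsub>i\<in>I\<^esub> l (v\<^sub>i)\<close> with \<open>|I| = k\<close>. The functions whose index set \<open>I\<close> consists of the indices outside
  an independent set \<open>S\<close> that are not externally active form a basis of the latter span: they span
  by straightening, and they are independent by deletion and contraction of the largest index.
  Activity is convenient here because \<open>i \<notin> S\<close> is externally active exactly if \<open>v\<^sub>i\<close> lies in the span
  of the \<open>v\<^sub>j\<close> with \<open>j \<in> S\<close> and \<open>j > i\<close>.
\<close>

section \<open>Spaces of coordinate vectors\<close>

text \<open>The index type is left open: subspaces of coordinate vectors indexed by numbers and
  subspaces of coefficient functions indexed by sets both occur.\<close>

definition function_space :: "('i \<Rightarrow> complex) set \<Rightarrow> bool" where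
  "function_space U \<longleftrightarrow> (\<lambda>_. 0) \<in> U \<and> (\<forall>x\<in>U. \<forall>y\<in>U. \<forall>c. (\<lambda>i. x i + c * y i) \<in> U)"

text \<open>Linear dependence expressed through functionals: for the coordinate space of a family
  \<open>v\<close> it becomes membership of \<open>v i\<close> in the span of the \<open>v j\<close>
  with \<open>j\<close> in \<open>T\<close>. In this form contraction of \<open>j\<close> is just
  restriction of \<open>U\<close> to \<open>x j = 0\<close>.\<close>

definition spanned :: "('i \<Rightarrow> complex) set \<Rightarrow> 'i set \<Rightarrow> 'i \<Rightarrow> bool" where
  "spanned U T i \<longleftrightarrow> (\<forall>x\<in>U. (\<forall>j\<in>T. x j = 0) \<longrightarrow> x i = 0)"

lemma function_space_zero: "function_space U \<Longrightarrow> (\<lambda>_. 0) \<in> U"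
  by (simp add: function_space_def)

lemma function_space_add_mult:
  "function_space U \<Longrightarrow> x \<in> U \<Longrightarrow> y \<in> U \<Longrightarrow> (\<lambda>i. x i + c * y i) \<in> U"
  by (simp add: function_space_def)

lemma function_space_add:
  "function_space U \<Longrightarrow> x \<in> U \<Longrightarrow> y \<in> U \<Longrightarrow> (\<lambda>i. x i + y i) \<in> U"
  using function_space_add_mult[of U x y 1] by simp

lemma function_space_sum:
  assumes "function_space U" "finite A" "\<And>s. s \<in> A \<Longrightarrow> f s \<in> U"
  shows "(\<lambda>i. \<Sum>s\<in>A. c s * f s i) \<in> U"
  using assms(2,3)
proof (induction A)
  case empty
  show ?case using assms(1) by (simp add: function_space_zero)
next
  case (insert s A)
  then have "(\<lambda>i. (\<Sum>s\<in>A. c s * f s i) + c s * f s i) \<in> U"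
    by (intro function_space_add_mult assms(1)) auto
  with insert show ?case by (simp add: add.commute)
qed

lemma function_space_coordinate_zero:
  "function_space U \<Longrightarrow> function_space {x \<in> U. x j = 0}"
  by (simp add: function_space_def)

lemma spanned_mono: "spanned U T i \<Longrightarrow> T \<subseteq> T' \<Longrightarrow> spanned U T' i"
  unfolding spanned_def by blast

lemma spanned_insert: "spanned U (insert j T) i \<longleftrightarrow> spanned {x \<in> U. x j = 0} T i"
  by (auto simp: spanned_def)

lemma spanned_linear_combination:
  assumes "function_space U" "finite T" "spanned U T i"
  obtains c where "\<And>x. x \<in> U \<Longrightarrow> x i = (\<Sum>j\<in>T. c j * x j)"
proof -
  have "\<exists>c. \<forall>x\<in>U. x i = (\<Sum>j\<in>T. c j * x j)"
    using assms(2,1,3)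
  proof (induction T arbitrary: U)
    case empty
    then show ?case by (simp add: spanned_def)
  next
    case (insert j T)
    let ?U = "{x \<in> U. x j = 0}"
    obtain c where c: "\<And>x. x \<in> U \<Longrightarrow> x j = 0 \<Longrightarrow> x i = (\<Sum>j\<in>T. c j * x j)"
      using insert.IH[of ?U] insert.prems
      by (auto simp: spanned_insert function_space_coordinate_zero)
    show ?case
    proof (cases "\<forall>x\<in>U. x j = 0")
      case True
      then show ?thesis using c insert.hyps by (intro exI[of _ c]) auto
    next
      case False
      then obtain z where z: "z \<in> U" "z j \<noteq> 0" by blast
      \<comment> \<open>Solves the desired identity at \<open>z\<close> for the coefficient of
        \<open>x j\<close>.\<close>
      define b where "b = (z i - (\<Sum>k\<in>T. c k * z k)) / z j"
      have "x i = (\<Sum>k\<in>insert j T. (c(j := b)) k * x k)" if x: "x \<in> U" for x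
      proof -
        let ?r = "x j / z j"
        let ?y = "\<lambda>k. x k + - ?r * z k"
        have "?y \<in> U" using insert.prems(1) x z(1) by (rule function_space_add_mult)
        moreover have "?y j = 0" using z(2) by simp
        ultimately have "?y i = (\<Sum>k\<in>T. c k * ?y k)" by (rule c)
        also have "\<dots> = (\<Sum>k\<in>T. c k * x k) - ?r * (\<Sum>k\<in>T. c k * z k)"
          by (simp add: sum_distrib_left algebra_simps sum_subtractf)
        finally have "x i = (\<Sum>k\<in>T. c k * x k) + b * x j"
          using z(2) by (simp add: b_def field_simps)
        moreover have "(\<Sum>k\<in>T. (c(j := b)) k * x k) = (\<Sum>k\<in>T. c k * x k)"
          using insert.hyps by (intro sum.cong) auto
        ultimately show ?thesis using insert.hyps by simp
      qed
      then show ?thesis by blast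
    qed
  qed
  then show thesis using that by blast
qed

text \<open>Row rank equals column rank for the matrix \<open>g s x\<close>. Since \<open>W\<close>
  may be any subspace that contains the evaluation vectors, it serves as a proof principle: linear
  properties pass from the evaluations to all vectors over \<open>A\<close>.\<close>

lemma evaluations_span:
  fixes g :: "'s \<Rightarrow> 'x \<Rightarrow> complex"
  assumes "finite A"
    and indep: "\<And>a. (\<And>x. x \<in> X \<Longrightarrow> (\<Sum>s\<in>A. a s * g s x) = 0) \<Longrightarrow> \<forall>s\<in>A. a s = 0"
    and W: "function_space W"
    and eval: "\<And>x. x \<in> X \<Longrightarrow> (\<lambda>s. g s x) \<in> W"
  shows "\<exists>w\<in>W. \<forall>s\<in>A. w s = b s"
  using assms(1) indep
proof (induction A arbitrary: b)
  case empty
  show ?case using function_space_zero[OF W] by auto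
next
  case (insert t A)
  have indep_A: "\<forall>s\<in>A. a s = 0" if a: "\<And>x. x \<in> X \<Longrightarrow> (\<Sum>s\<in>A. a s * g s x) = 0" for a
  proof -
    have "(\<Sum>s\<in>insert t A. (a(t := 0)) s * g s x) = (\<Sum>s\<in>A. a s * g s x)" for x
      using insert.hyps by (auto intro!: sum.cong)
    then have "\<forall>s\<in>insert t A. (a(t := 0)) s = 0"
      using insert.prems[of "a(t := 0)"] a by simp
    then show ?thesis using insert.hyps by (metis fun_upd_other insertCI)
  qed
  \<comment> \<open>The unit vectors over \<open>A\<close>, realised by elements of
    \<open>W\<close>.\<close>
  have "\<exists>w\<in>W. \<forall>s\<in>A. w s = (if s = r then 1 else 0)" for r
    by (rule insert.IH[OF indep_A])
  then obtain D where D: "\<And>r. D r \<in> W" "\<And>r s. s \<in> A \<Longrightarrow> D r s = (if s = r then 1 else 0)"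
    by metis
  \<comment> \<open>\<open>g t\<close> minus its interpolation by the \<open>g s\<close>; independence makes it nonzero somewhere\<close>
  let ?h = "\<lambda>x. g t x - (\<Sum>s\<in>A. D s t * g s x)"
  have "\<exists>x\<in>X. ?h x \<noteq> 0"
  proof (rule ccontr)
    assume none: "\<not> ?thesis"
    have "(\<Sum>s\<in>A. ((\<lambda>s. - D s t)(t := 1)) s * g s x) = (\<Sum>s\<in>A. - (D s t * g s x))" for x
      using insert.hyps by (intro sum.cong) auto
    then have "(\<Sum>s\<in>insert t A. ((\<lambda>s. - D s t)(t := 1)) s * g s x) = ?h x" for x
      using insert.hyps by (simp add: sum_negf)
    then have "\<forall>s\<in>insert t A. ((\<lambda>s. - D s t)(t := 1)) s = 0"
      using insert.prems[of "(\<lambda>s. - D s t)(t := 1)"] none by auto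
    then show False by simp
  qed
  then obtain x where x: "x \<in> X" "?h x \<noteq> 0" by blast
  let ?sum = "\<lambda>u s. \<Sum>r\<in>A. u r * D r s"
  have sum_in: "?sum u \<in> W" for u using W insert.hyps D by (intro function_space_sum) auto
  have sum_eq: "?sum u s = u s" if "s \<in> A" for u s
    using that insert.hyps by (subst sum.remove[of A s]) (auto simp: D(2)[OF that] split: if_splits intro!: sum.neutral)
  \<comment> \<open>The evaluation at \<open>x\<close> minus its interpolation on \<open>A\<close>:
    it is zero on \<open>A\<close> and equals the nonzero \<open>?h x\<close> at \<open>t\<close>,
    so it can adjust the value at \<open>t\<close> without disturbing \<open>A\<close>.\<close>
  let ?E = "\<lambda>s. g s x + -1 * ?sum (\<lambda>r. g r x) s"
  have E: "?E \<in> W" by (rule function_space_add_mult[OF W eval[OF x(1)] sum_in])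
  have E0: "?E s = 0" if "s \<in> A" for s using sum_eq[OF that] by simp
  have Et: "?E t = ?h x" by (simp add: mult.commute)
  obtain e where e: "e \<in> W" "\<And>s. s \<in> A \<Longrightarrow> e s = 0" "e t \<noteq> 0"
    using that[of ?E] E E0 Et x(2) by metis
  obtain q where q: "q \<in> W" "\<And>s. s \<in> A \<Longrightarrow> q s = b s"
    using that[of "?sum b"] sum_in sum_eq by metis
  let ?w = "\<lambda>s. q s + (b t - q t) / e t * e s"
  have "\<forall>s\<in>insert t A. ?w s = b s" using q(2) e(2,3) by simp
  moreover have "?w \<in> W" by (rule function_space_add_mult[OF W q(1) e(1)])
  ultimately show ?case by (rule bexI[where x = ?w])
qed

section \<open>Products over inactive indices\<close>

text \<open>Only larger indices are tested: scanning downwards, each element of \<open>S\<close> has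
  to be new. This is enough for linear independence and is the same test that decides external
  activity.\<close>

definition indeps :: "(nat \<Rightarrow> complex) set \<Rightarrow> nat \<Rightarrow> nat set set" where
  "indeps U N = {S. S \<subseteq> {1..N} \<and> (\<forall>i\<in>S. \<not> spanned U (S \<inter> {i<..}) i)}"

definition inactive :: "(nat \<Rightarrow> complex) set \<Rightarrow> nat \<Rightarrow> nat set \<Rightarrow> nat set" where
  "inactive U N S = {i \<in> {1..N} - S. \<not> spanned U (S \<inter> {i<..}) i}"

lemma finite_indeps: "finite (indeps U N)"
  by (rule finite_subset[of _ "Pow {1..N}"]) (auto simp: indeps_def)

lemma inactive_subset: "inactive U N S \<subseteq> {1..N}"
  by (auto simp: inactive_def)

lemma finite_inactive [simp]: "finite (inactive U N S)"
  using finite_subset[OF inactive_subset] by blast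

section \<open>Greedy bases and straightening\<close>

text \<open>\<open>S\<close> is the greedy basis of the complement \<open>A\<close> of
  \<open>I\<close>, built from the largest index down. Above any index, \<open>S\<close> and
  \<open>A\<close> span the same space, so every test against \<open>S\<close> may be made against
  \<open>A\<close>.\<close>

lemma greedy_indep:
  fixes U :: "(nat \<Rightarrow> complex) set" and I :: "nat set"
  assumes "I \<subseteq> {1..N}"
  defines "A \<equiv> {1..N} - I"
  defines "S \<equiv> {i \<in> A. \<not> spanned U (A \<inter> {i<..}) i}"
  shows "S \<in> indeps U N" and "inactive U N S = {i \<in> I. \<not> spanned U (A \<inter> {i<..}) i}"
proof -
  \<comment> \<open>Downward induction on \<open>j\<close>: an element of \<open>A\<close> outside
    \<open>S\<close> depends on larger elements of \<open>A\<close>, where \<open>x\<close> is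
    already known to vanish.\<close>
  have vanish: "x j = 0" if x: "x \<in> U" "\<forall>j \<in> S \<inter> {i<..}. x j = 0" and j: "j \<in> A" "i < j" for x i j
    using j
  proof (induction "N - j" arbitrary: j rule: less_induct)
    case less
    show ?case
    proof (cases "j \<in> S")
      case True
      then show ?thesis using x less.prems by auto
    next
      case False
      then have "spanned U (A \<inter> {j<..}) j" using less.prems by (auto simp: S_def)
      moreover have "x k = 0" if k: "k \<in> A \<inter> {j<..}" for k
        using k less.prems by (intro less.hyps) (auto simp: A_def)
      ultimately show ?thesis using x(1) by (auto simp: spanned_def)
    qed
  qed
  have eq: "spanned U (S \<inter> {i<..}) i \<longleftrightarrow> spanned U (A \<inter> {i<..}) i" for i
  proof
    show "spanned U (S \<inter> {i<..}) i \<Longrightarrow> spanned U (A \<inter> {i<..}) i"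
      by (erule spanned_mono) (auto simp: S_def)
    show "spanned U (A \<inter> {i<..}) i \<Longrightarrow> spanned U (S \<inter> {i<..}) i"
      unfolding spanned_def[of U "A \<inter> _"] unfolding spanned_def using vanish by blast
  qed
  show "S \<in> indeps U N"
    unfolding indeps_def using eq by (auto simp: S_def A_def)
  show "inactive U N S = {i \<in> I. \<not> spanned U (A \<inter> {i<..}) i}"
    unfolding inactive_def eq using assms(1) by (auto simp: S_def A_def)
qed

text \<open>
  If \<open>I\<close> is not the inactive set of the greedy basis of its complement, some factor \<open>x i\<close> is a
  combination of \<open>x j\<close> with \<open>j > i\<close> and \<open>j \<notin> I\<close>. The replacement increases the sum of the
  indices, so it terminates.
\<close>

lemma straightening:
  assumes U: "function_space U" and "I \<subseteq> {1..N}"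
  shows "\<exists>c. (\<forall>S. card (inactive U N S) \<noteq> card I \<longrightarrow> c S = 0) \<and>
    (\<forall>x\<in>U. (\<Prod>i\<in>I. x i) = (\<Sum>S\<in>indeps U N. c S * (\<Prod>i\<in>inactive U N S. x i)))"
  using assms(2)
proof (induction "N * N - \<Sum>I" arbitrary: I rule: less_induct)
  case less
  have fin: "finite I" using less.prems finite_subset by blast
  let ?A = "{1..N} - I"
  show ?case
  proof (cases "\<exists>i\<in>I. spanned U (?A \<inter> {i<..}) i")
    case False
    let ?S = "{i \<in> ?A. \<not> spanned U (?A \<inter> {i<..}) i}"
    \<comment> \<open>No factor can be exchanged, so \<open>I\<close> is itself an inactive set and
      its product needs no rewriting.\<close>
    have "inactive U N ?S = I" using greedy_indep(2)[OF less.prems, of U] False by auto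
    then show ?thesis
      using greedy_indep(1)[OF less.prems, of U] finite_indeps[of U N]
      by (intro exI[of _ "\<lambda>T. if T = ?S then 1 else 0"])
        (auto simp: if_distrib[of "\<lambda>c. c * _"] cong: if_cong)
  next
    case True
    then obtain i where i: "i \<in> I" "spanned U (?A \<inter> {i<..}) i" by blast
    let ?T = "?A \<inter> {i<..}"
    obtain b where b: "\<And>x. x \<in> U \<Longrightarrow> x i = (\<Sum>j\<in>?T. b j * x j)"
      using spanned_linear_combination[OF U _ i(2)] by auto
    let ?J = "\<lambda>j. insert j (I - {i})"
    have "\<exists>c. (\<forall>S. card (inactive U N S) \<noteq> card I \<longrightarrow> c S = 0) \<and>
        (\<forall>x\<in>U. (\<Prod>k\<in>?J j. x k) = (\<Sum>S\<in>indeps U N. c S * (\<Prod>i\<in>inactive U N S. x i)))"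
      if j: "j \<in> ?T" for j
    proof -
      have J: "?J j \<subseteq> {1..N}" using j less.prems by auto
      \<comment> \<open>The exchange keeps the degree; hence only inactive sets of size
        \<open>card I\<close> receive a nonzero coefficient.\<close>
      have card: "card (?J j) = card I"
        using j fin card_Suc_Diff1[OF fin i(1)] by (subst card_insert_disjoint) auto
      have "\<Sum>(?J j) = j + \<Sum>(I - {i})" using j fin by (subst sum.insert) auto
      moreover have "\<Sum>I = i + \<Sum>(I - {i})" by (rule sum.remove[OF fin i(1)])
      ultimately have lt: "\<Sum>I < \<Sum>(?J j)" using j by auto
      \<comment> \<open>The index sum never exceeds \<open>N * N\<close>, so the truncated
        difference used as measure really drops.\<close>
      have "\<Sum>(?J j) \<le> \<Sum>{1..N}" by (rule sum_mono2) (use J in auto)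
      also have "\<dots> \<le> (\<Sum>i\<in>{1..N}. N)" by (rule sum_mono) auto
      finally have "\<Sum>(?J j) \<le> N * N" by simp
      then have "N * N - \<Sum>(?J j) < N * N - \<Sum>I" using lt by linarith
      from less.hyps[OF this J] show ?thesis using card by simp
    qed
    then have "\<exists>c. \<forall>j\<in>?T. (\<forall>S. card (inactive U N S) \<noteq> card I \<longrightarrow> c j S = 0) \<and>
        (\<forall>x\<in>U. (\<Prod>k\<in>?J j. x k) = (\<Sum>S\<in>indeps U N. c j S * (\<Prod>i\<in>inactive U N S. x i)))"
      by (intro bchoice) blast
    then obtain c where
      c: "\<And>j S. j \<in> ?T \<Longrightarrow> card (inactive U N S) \<noteq> card I \<Longrightarrow> c j S = 0"
        "\<And>j x. j \<in> ?T \<Longrightarrow> x \<in> U \<Longrightarrow>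
          (\<Prod>k\<in>?J j. x k) = (\<Sum>S\<in>indeps U N. c j S * (\<Prod>i\<in>inactive U N S. x i))"
      by blast
    let ?c = "\<lambda>S. \<Sum>j\<in>?T. b j * c j S"
    have "(\<Prod>k\<in>I. x k) = (\<Sum>S\<in>indeps U N. ?c S * (\<Prod>i\<in>inactive U N S. x i))" if x: "x \<in> U" for x
    proof -
      have "(\<Prod>k\<in>I. x k) = (\<Sum>j\<in>?T. b j * (x j * (\<Prod>k\<in>I - {i}. x k)))"
        unfolding prod.remove[OF fin i(1)] by (simp only: b[OF x] sum_distrib_right mult.assoc)
      also have "\<dots> = (\<Sum>j\<in>?T. b j * (\<Prod>k\<in>?J j. x k))"
        using fin by (intro sum.cong) auto
      also have "\<dots> = (\<Sum>j\<in>?T. \<Sum>S\<in>indeps U N. b j * c j S * (\<Prod>i\<in>inactive U N S. x i))"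
        by (intro sum.cong refl) (simp add: c(2)[OF _ x] sum_distrib_left mult.assoc)
      also have "\<dots> = (\<Sum>S\<in>indeps U N. ?c S * (\<Prod>i\<in>inactive U N S. x i))"
        by (subst sum.swap) (simp add: sum_distrib_right)
      finally show ?thesis .
    qed
    moreover have "?c S = 0" if "card (inactive U N S) \<noteq> card I" for S
      using c(1) that by (simp add: sum.neutral)
    ultimately show ?thesis by (intro exI[of _ ?c]) blast
  qed
qed

section \<open>Independence by deletion and contraction\<close>

text \<open>The factor \<open>x n\<close> can be cancelled even where it is zero: on the line
  \<open>x + t z\<close> the coordinate \<open>n\<close> is then nonzero for all nonzero
  \<open>t\<close>, and continuity at \<open>t = 0\<close> gives the claim.\<close>

lemma vanish_by_density:
  assumes U: "function_space U" and z: "z \<in> U" "z n \<noteq> 0" and "finite A"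
    and vanish: "\<And>x. x \<in> U \<Longrightarrow> x n * (\<Sum>S\<in>A. a S * (\<Prod>i\<in>f S. x i)) = (0 :: complex)"
    and x: "x \<in> U"
  shows "(\<Sum>S\<in>A. a S * (\<Prod>i\<in>f S. x i)) = 0"
proof (cases "x n = 0")
  case False
  then show ?thesis using vanish[OF x] by simp
next
  case True
  let ?g = "\<lambda>t. \<Sum>S\<in>A. a S * (\<Prod>i\<in>f S. x i + t * z i)"
  have "isCont ?g 0" by (intro continuous_intros)
  then have "?g \<midarrow>0\<rightarrow> ?g 0" by (simp add: isCont_def)
  moreover have "?g t = 0" if "t \<noteq> 0" for t
    using vanish[OF function_space_add_mult[OF U x z(1), of t]] that True z(2) by simp
  then have "?g \<midarrow>0\<rightarrow> 0"
    by (intro tendsto_eventually) (auto simp: eventually_at_filter)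
  ultimately show ?thesis using LIM_unique by fastforce
qed

text \<open>
  Deletion and contraction of the largest index \<open>N + 1\<close>: the independent sets containing it
  correspond to those of the subspace where the coordinate \<open>N + 1\<close> vanishes, with the same inactive
  indices. For the other independent sets \<open>N + 1\<close> is inactive, unless it is a loop.
\<close>

lemma indeps_Suc_insert:
  assumes "Suc N \<notin> S"
  shows "insert (Suc N) S \<in> indeps U (Suc N) \<longleftrightarrow>
      \<not> spanned U {} (Suc N) \<and> S \<in> indeps {x \<in> U. x (Suc N) = 0} N"
    and "S \<in> indeps U (Suc N) \<longleftrightarrow> S \<in> indeps U N"
proof -
  have le: "insert (Suc N) S \<subseteq> {1..Suc N} \<longleftrightarrow> S \<subseteq> {1..N}" "S \<subseteq> {1..Suc N} \<longleftrightarrow> S \<subseteq> {1..N}"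
    using assms by (auto simp: subset_iff le_Suc_eq)
  have "insert (Suc N) S \<inter> {i<..} = insert (Suc N) (S \<inter> {i<..})"
    if "S \<subseteq> {1..N}" "i \<in> S" for i
    using that by auto
  moreover have "insert (Suc N) S \<inter> {Suc N<..} = {}" if "S \<subseteq> {1..N}"
    using that by auto
  ultimately show "insert (Suc N) S \<in> indeps U (Suc N) \<longleftrightarrow>
      \<not> spanned U {} (Suc N) \<and> S \<in> indeps {x \<in> U. x (Suc N) = 0} N"
    unfolding indeps_def mem_Collect_eq le by (auto simp: spanned_insert)
  show "S \<in> indeps U (Suc N) \<longleftrightarrow> S \<in> indeps U N"
    unfolding indeps_def mem_Collect_eq le ..
qed

lemma inactive_Suc_insert:
  assumes "S \<subseteq> {1..N}"
  shows "inactive U (Suc N) (insert (Suc N) S) = inactive {x \<in> U. x (Suc N) = 0} N S"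
    and "inactive U (Suc N) S =
      (if spanned U {} (Suc N) then inactive U N S else insert (Suc N) (inactive U N S))"
proof -
  have "insert (Suc N) S \<inter> {i<..} = insert (Suc N) (S \<inter> {i<..})" if "i \<le> N" for i
    using that by auto
  then show "inactive U (Suc N) (insert (Suc N) S) = inactive {x \<in> U. x (Suc N) = 0} N S"
    using assms by (auto simp: inactive_def spanned_insert le_Suc_eq)
  have empty: "S \<inter> {Suc N<..} = {}" and notin: "Suc N \<notin> S" using assms by auto
  have "{1..Suc N} - S = insert (Suc N) ({1..N} - S)" using notin by auto
  then show "inactive U (Suc N) S =
      (if spanned U {} (Suc N) then inactive U N S else insert (Suc N) (inactive U N S))"
    unfolding inactive_def using empty by auto
qed

text \<open>With \<open>n\<close> the largest index, a relation splits into \<open>x n\<close> times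
  a relation for the deletion plus one for the contraction. Restricting to \<open>x n = 0\<close>
  leaves the contraction, whose coefficients vanish by induction; then \<open>x n\<close> is
  cancelled by density and induction applies to the deletion.\<close>

lemma inactive_products_independent:
  assumes "function_space U"
    and "\<And>x. x \<in> U \<Longrightarrow> (\<Sum>S\<in>indeps U N. a S * (\<Prod>i\<in>inactive U N S. x i)) = 0"
  shows "\<forall>S\<in>indeps U N. a S = 0"
  using assms
proof (induction N arbitrary: U a)
  case 0
  have "indeps U 0 = {{}}" "inactive U 0 {} = {}" by (auto simp: indeps_def inactive_def)
  then show ?case using 0(2)[OF function_space_zero[OF 0(1)]] by simp
next
  case (Suc N)
  note U = Suc.prems(1)
  let ?n = "Suc N"
  have notin: "?n \<notin> S" "S \<subseteq> {1..N}" if "S \<in> indeps V N" for S V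
    using that by (auto simp: indeps_def)
  show ?case
  proof (cases "spanned U {} ?n")
    case True
    \<comment> \<open>A loop: coordinate \<open>?n\<close> vanishes on \<open>U\<close>, so no
      independent set contains \<open>?n\<close> and \<open>?n\<close> is never inactive.\<close>
    have eq: "indeps U ?n = indeps U N"
    proof (intro Set.set_eqI)
      fix S
      show "S \<in> indeps U ?n \<longleftrightarrow> S \<in> indeps U N"
      proof (cases "?n \<in> S")
        case True': True
        then have "S = insert ?n (S - {?n})" by blast
        then have "S \<notin> indeps U ?n" using indeps_Suc_insert(1)[of N "S - {?n}" U] True by auto
        then show ?thesis using True' notin(1) by blast
      qed (rule indeps_Suc_insert(2))
    qed
    have "(\<Sum>S\<in>indeps U N. a S * (\<Prod>i\<in>inactive U N S. x i)) = 0" if "x \<in> U" for x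
      using Suc.prems(2)[OF that] notin True unfolding eq
      by (simp add: inactive_Suc_insert(2) cong: sum.cong)
    then show ?thesis using Suc.IH[OF U] eq by simp
  next
    case False
    let ?U = "{x \<in> U. x ?n = 0}"
    have eq: "indeps U ?n = indeps U N \<union> insert ?n ` indeps ?U N"
    proof (intro Set.set_eqI)
      fix S
      show "S \<in> indeps U ?n \<longleftrightarrow> S \<in> indeps U N \<union> insert ?n ` indeps ?U N"
      proof (cases "?n \<in> S")
        case True
        then have S: "S = insert ?n (S - {?n})" by blast
        have "S \<in> indeps U ?n \<longleftrightarrow> S - {?n} \<in> indeps ?U N"
          by (subst S, subst indeps_Suc_insert(1)) (use False in auto)
        moreover have "S \<in> insert ?n ` indeps ?U N \<longleftrightarrow> S - {?n} \<in> indeps ?U N"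
          using S notin(1) by (metis (no_types, lifting) Diff_insert_absorb image_iff)
        ultimately show ?thesis using True notin(1)[of S U] by auto
      next
        case False
        then show ?thesis using indeps_Suc_insert(2)[OF False] by auto
      qed
    qed
    have inj: "inj_on (insert ?n) (indeps ?U N)"
      by (rule inj_onI) (metis Diff_insert_absorb notin(1))
    \<comment> \<open>Sets without \<open>?n\<close> have \<open>?n\<close> among their inactive
      indices and carry the factor \<open>x ?n\<close>; sets with \<open>?n\<close> do not.\<close>
    have split: "(\<Sum>S\<in>indeps U ?n. a S * (\<Prod>i\<in>inactive U ?n S. x i)) =
        x ?n * (\<Sum>S\<in>indeps U N. a S * (\<Prod>i\<in>inactive U N S. x i)) +
        (\<Sum>S\<in>indeps ?U N. a (insert ?n S) * (\<Prod>i\<in>inactive ?U N S. x i))" for x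
    proof -
      have "?n \<notin> inactive U N S" for S using inactive_subset[of U N S] by auto
      then show ?thesis
        unfolding eq using False notin
        by (subst sum.union_disjoint)
          (auto simp: finite_indeps sum.reindex[OF inj] inactive_Suc_insert sum_distrib_left
            mult.left_commute cong: sum.cong)
    qed
    have contraction: "\<forall>S\<in>indeps ?U N. a (insert ?n S) = 0"
    proof (rule Suc.IH[OF function_space_coordinate_zero[OF U]])
      fix x assume "x \<in> ?U"
      then show "(\<Sum>S\<in>indeps ?U N. a (insert ?n S) * (\<Prod>i\<in>inactive ?U N S. x i)) = 0"
        using Suc.prems(2)[of x] split[of x] by simp
    qed
    obtain z where z: "z \<in> U" "z ?n \<noteq> 0" using False by (auto simp: spanned_def)
    have "\<forall>S\<in>indeps U N. a S = 0"
    proof (rule Suc.IH[OF U], rule vanish_by_density[OF U z finite_indeps])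
      fix x assume "x \<in> U"
      then show "x ?n * (\<Sum>S\<in>indeps U N. a S * (\<Prod>i\<in>inactive U N S. x i)) = 0"
        using Suc.prems(2)[of x] split[of x] contraction by simp
    qed
    then show ?thesis using contraction eq by auto
  qed
qed

section \<open>Linear independence in terms of coordinates\<close>

definition coord_space ::
  "(complex \<Rightarrow> 'e \<Rightarrow> 'e) \<Rightarrow> (nat \<Rightarrow> 'e::ab_group_add) \<Rightarrow> (nat \<Rightarrow> complex) set" where
  "coord_space scale v = {\<lambda>i. l (v i) | l. Vector_Spaces.linear scale (*) l}"

lemma vector_space_pair_complex:
  "vector_space scale \<Longrightarrow> vector_space_pair scale ((*) :: complex \<Rightarrow> complex \<Rightarrow> complex)"
  by (simp add: vector_space_pair_def vector_space_def algebra_simps)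

lemma function_space_coord_space:
  assumes "vector_space scale"
  shows "function_space (coord_space scale v)"
proof -
  interpret vector_space_pair scale "(*) :: complex \<Rightarrow> complex \<Rightarrow> complex"
    using assms by (rule vector_space_pair_complex)
  show ?thesis
    unfolding function_space_def coord_space_def
  proof (safe)
    show "\<exists>l. (\<lambda>_. 0) = (\<lambda>i. l (v i)) \<and> Vector_Spaces.linear scale (*) l"
      using linear_zero by (intro exI[of _ "\<lambda>_. 0"]) simp
  next
    fix l m :: "'a \<Rightarrow> complex" and c
    assume lm: "Vector_Spaces.linear scale (*) l" "Vector_Spaces.linear scale (*) m"
    show "\<exists>k. (\<lambda>i. l (v i) + c * m (v i)) = (\<lambda>i. k (v i)) \<and> Vector_Spaces.linear scale (*) k"
      using linear_compose_add[OF lm(1) linear_compose_scale_right[OF lm(2), of c]]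
      by (intro exI[of _ "\<lambda>x. l x + c * m x"]) simp
  qed
qed

text \<open>If \<open>v i\<close> is outside the span, a functional that is 1 at \<open>v i\<close>
  and 0 on a basis of the span separates them. Conversely, a functional vanishing on generators
  vanishes on their span.\<close>

lemma spanned_coord_space:
  assumes "vector_space scale"
  shows "spanned (coord_space scale v) T i \<longleftrightarrow> v i \<in> module.span scale (v ` T)"
proof -
  interpret vector_space_pair scale "(*) :: complex \<Rightarrow> complex \<Rightarrow> complex"
    using assms by (rule vector_space_pair_complex)
  show ?thesis
  proof
    assume *: "v i \<in> vs1.span (v ` T)"
    show "spanned (coord_space scale v) T i"
      unfolding spanned_def coord_space_def
    proof (safe)
      fix l assume l: "Vector_Spaces.linear scale (*) l" "\<forall>j\<in>T. l (v j) = 0"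
      show "l (v i) = 0"
        using linear_eq_on_span[OF l(1) linear_zero _ *] l(2) by auto
    qed
  next
    assume *: "spanned (coord_space scale v) T i"
    show "v i \<in> vs1.span (v ` T)"
    proof (rule ccontr)
      assume notin: "v i \<notin> vs1.span (v ` T)"
      obtain B where B: "B \<subseteq> v ` T" "vs1.independent B" "vs1.span B = vs1.span (v ` T)"
        using vs1.maximal_independent_subset[of "v ` T"] vs1.span_mono vs1.span_superset
        by (metis subset_antisym vs1.span_subspace vs1.subspace_span)
      have "vs1.independent (insert (v i) B)"
        using notin B by (auto simp: vs1.independent_insert)
      then obtain l where l: "Vector_Spaces.linear scale (*) l"
        "\<And>x. x \<in> insert (v i) B \<Longrightarrow> l x = (if x = v i then 1 else 0)"
        using linear_independent_extend[of _ "\<lambda>x. if x = v i then 1 else 0"] by blast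
      have "l x = 0" if "x \<in> B" for x
        using that l(2)[of x] notin B(3) vs1.span_base[of x B] by auto
      then have "l x = 0" if "x \<in> vs1.span (v ` T)" for x
        using linear_eq_on_span[OF l(1) linear_zero, of B x] that B(3) by auto
      then have vanish: "\<forall>j\<in>T. l (v j) = 0" by (simp add: vs1.span_base)
      have mem: "(\<lambda>i. l (v i)) \<in> coord_space scale v"
        using l(1) by (auto simp: coord_space_def)
      have "l (v i) = 0" using bspec[OF *[unfolded spanned_def] mem] vanish by simp
      then show False using l(2)[of "v i"] by simp
    qed
  qed
qed

lemma indep_subset_iff_indeps:
  assumes "vector_space scale"
  shows "indep_subset scale N v S \<longleftrightarrow> S \<in> indeps (coord_space scale v) N"
proof -
  interpret vector_space scale by fact
  show ?thesis
  proof
    assume S: "indep_subset scale N v S"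
    have "v i \<notin> span (v ` (S \<inter> {i<..}))" if i: "i \<in> S" for i
    proof
      assume "v i \<in> span (v ` (S \<inter> {i<..}))"
      moreover have "v ` (S \<inter> {i<..}) \<subseteq> v ` S - {v i}"
        using S i by (auto simp: indep_subset_def inj_on_def)
      ultimately have "v i \<in> span (v ` S - {v i})" using span_mono by blast
      then show False using S i by (auto simp: indep_subset_def dependent_def)
    qed
    then show "S \<in> indeps (coord_space scale v) N"
      using S by (auto simp: indeps_def spanned_coord_space[OF assms] indep_subset_def)
  next
    assume S: "S \<in> indeps (coord_space scale v) N"
    then have fin: "finite S" using finite_subset by (auto simp: indeps_def)
    have "\<forall>i\<in>S. v i \<notin> span (v ` (S \<inter> {i<..}))"
      using S by (auto simp: indeps_def spanned_coord_space[OF assms])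
    \<comment> \<open>The induction inserts a new minimum \<open>b\<close>, so the elements of the
      set above \<open>b\<close> are exactly those treated before.\<close>
    with fin have "inj_on v S \<and> independent (v ` S)"
    proof (induction S rule: finite_linorder_min_induct)
      case empty
      show ?case by (simp add: independent_empty)
    next
      case (insert b A)
      have "insert b A \<inter> {b<..} = A" using insert.hyps by auto
      then have b: "v b \<notin> span (v ` A)" using insert.prems by force
      have "insert b A \<inter> {i<..} = A \<inter> {i<..}" if "i \<in> A" for i
        using insert.hyps that by auto
      then have "inj_on v A \<and> independent (v ` A)" using insert by auto
      then show ?case using b span_base by (auto simp: independent_insert)
    qed
    then show "indep_subset scale N v S" using S by (auto simp: indep_subset_def indeps_def)
  qed
qed

text \<open>The other elements of a cycle with minimum \<open>i\<close> lie in \<open>S\<close>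
  above \<open>i\<close> and are independent, so \<open>v i\<close> is in their span. Conversely, a
  minimal dependent subset of \<open>i\<close> together with the part of \<open>S\<close> above
  \<open>i\<close> is a cycle, and it contains \<open>i\<close> because subsets of \<open>S\<close>
  are independent.\<close>

lemma ext_active_iff_spanned:
  assumes "vector_space scale" and S: "indep_subset scale N v S"
  shows "ext_active scale N v S i \<longleftrightarrow>
    i \<in> {1..N} - S \<and> spanned (coord_space scale v) (S \<inter> {i<..}) i"
proof -
  interpret vector_space scale by fact
  have subset_indep: "indep_subset scale N v T" if "T \<subseteq> S" for T
    using S that dependent_mono[of "v ` T" "v ` S"] by (auto simp: indep_subset_def inj_on_subset)
  show ?thesis
  proof
    assume "ext_active scale N v S i"
    then obtain C where i: "i \<in> {1..N} - S"
      and C: "C \<subseteq> S \<union> {i}" "is_cycle scale N v C" "i \<in> C" "\<forall>j\<in>C. i \<le> j"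
      by (auto simp: ext_active_def)
    obtain D where CD: "C = insert i D" "i \<notin> D" using C(3) by (metis mk_disjoint_insert)
    have D: "D \<subseteq> S \<inter> {i<..}" using C CD i by fastforce
    then have indep: "indep_subset scale N v D" using subset_indep by blast
    have not_indep: "\<not> indep_subset scale N v (insert i D)" using C(2) CD by (simp add: is_cycle_def)
    have "v i \<in> span (v ` D)"
    proof (rule ccontr)
      assume notin: "v i \<notin> span (v ` D)"
      then have "v i \<notin> v ` D" using span_base by blast
      then show False
        using not_indep indep i notin CD(2) by (simp add: indep_subset_def independent_insert)
    qed
    then have "v i \<in> span (v ` (S \<inter> {i<..}))" using span_mono[OF image_mono[OF D]] by blast
    then show "i \<in> {1..N} - S \<and> spanned (coord_space scale v) (S \<inter> {i<..}) i"
      using i by (simp add: spanned_coord_space[OF assms(1)])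
  next
    assume i: "i \<in> {1..N} - S \<and> spanned (coord_space scale v) (S \<inter> {i<..}) i"
    let ?T = "insert i (S \<inter> {i<..})"
    have T: "?T \<subseteq> {1..N}" using i S by (auto simp: indep_subset_def)
    have "spanned (coord_space scale v) (?T \<inter> {i<..}) i"
      using i spanned_mono[of _ "S \<inter> {i<..}" i "?T \<inter> {i<..}"] by blast
    then have "\<not> indep_subset scale N v ?T"
      by (auto simp: indep_subset_iff_indeps[OF assms(1)] indeps_def)
    then obtain C where C: "C \<subseteq> ?T" "\<not> indep_subset scale N v C"
      "\<And>D. D \<subseteq> ?T \<Longrightarrow> \<not> indep_subset scale N v D \<Longrightarrow> D \<subseteq> C \<Longrightarrow> C = D"
      using finite_has_minimal2[of "{D. D \<subseteq> ?T \<and> \<not> indep_subset scale N v D}" ?T]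
        finite_subset[OF T] by auto
    have "is_cycle scale N v C"
      unfolding is_cycle_def using C T by blast
    moreover have "i \<in> C" using C(1,2) subset_indep[of C] by blast
    moreover have "C \<subseteq> S \<union> {i}" "\<forall>j\<in>C. i \<le> j" using C(1) by auto
    ultimately show "ext_active scale N v S i" using i unfolding ext_active_def by blast
  qed
qed

lemma card_inactive:
  assumes "vector_space scale" and S: "indep_subset scale N v S"
  shows "int (card (inactive (coord_space scale v) N S)) =
    int N - int (card S) - int (act scale N v S)"
proof -
  let ?E = "{i. ext_active scale N v S i}"
  have sub: "S \<subseteq> {1..N}" using S by (simp add: indep_subset_def)
  have E: "?E \<subseteq> {1..N} - S" by (auto simp: ext_active_def)
  have "inactive (coord_space scale v) N S = {1..N} - S - ?E"
    by (auto simp only: inactive_def ext_active_iff_spanned[OF assms])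
  moreover have "card ({1..N} - S - ?E) = card ({1..N} - S) - card ?E"
    using E finite_subset[OF E] by (intro card_Diff_subset) auto
  moreover have "card ?E \<le> card ({1..N} - S)" using E by (intro card_mono) auto
  moreover have "card ({1..N} - S) = N - card S"
    using sub finite_subset[OF sub] by (simp add: card_Diff_subset)
  moreover have "card S \<le> N" using card_mono[OF _ sub] by simp
  ultimately show ?thesis by (simp add: act_def)
qed

section \<open>Computing modulo the squares\<close>

lemma cconst_add: "cconst (a + b) = cconst a + cconst b"
  by (simp add: cconst_def single_add)

lemma cconst_mult: "cconst (a * b) = cconst a * cconst b"
  by (simp add: cconst_def mult_single)

lemma cconst_0 [simp]: "cconst 0 = 0" and cconst_1 [simp]: "cconst 1 = 1"
  by (simp_all add: cconst_def)

lemma cconst_sum: "cconst (\<Sum>i\<in>A. f i) = (\<Sum>i\<in>A. cconst (f i))"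
  by (induction A rule: infinite_finite_induct) (simp_all add: cconst_add)

lemma cconst_prod: "cconst (\<Prod>i\<in>A. f i) = (\<Prod>i\<in>A. cconst (f i))"
  by (induction A rule: infinite_finite_induct) (simp_all add: cconst_mult)

declare sym_alg_simps(1) [simp del]

lemma sym_alg_sum:
  "(\<And>i. i \<in> A \<Longrightarrow> f i \<in> carrier (sym_alg N)) \<Longrightarrow> (\<Sum>i\<in>A. f i) \<in> carrier (sym_alg N)"
  using sym_alg_closed(4)[of 0 N]
  by (induction A rule: infinite_finite_induct) (simp_all add: sym_alg_closed)

lemma sym_alg_prod:
  "(\<And>i. i \<in> A \<Longrightarrow> f i \<in> carrier (sym_alg N)) \<Longrightarrow> (\<Prod>i\<in>A. f i) \<in> carrier (sym_alg N)"
  using sym_alg_closed(4)[of 1 N]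
  by (induction A rule: infinite_finite_induct) (simp_all add: sym_alg_closed)

lemma sym_alg_power: "p \<in> carrier (sym_alg N) \<Longrightarrow> p ^ k \<in> carrier (sym_alg N)"
  using sym_alg_prod[of "{..<k}" "\<lambda>_. p" N] by simp

lemma Phi_class_add:
  "p \<in> carrier (sym_alg N) \<Longrightarrow> q \<in> carrier (sym_alg N) \<Longrightarrow>
    Phi_class N (p + q) = Phi_class N p \<oplus>\<^bsub>Phi N\<^esub> Phi_class N q"
  using ring_hom_add[OF Phi_class_hom] by fastforce

lemma Phi_class_mult:
  "p \<in> carrier (sym_alg N) \<Longrightarrow> q \<in> carrier (sym_alg N) \<Longrightarrow>
    Phi_class N (p * q) = Phi_class N p \<otimes>\<^bsub>Phi N\<^esub> Phi_class N q"
  using ring_hom_mult[OF Phi_class_hom] by fastforce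

lemma Phi_class_one: "Phi_class N 1 = \<one>\<^bsub>Phi N\<^esub>"
  using ring_hom_one[OF Phi_class_hom] by fastforce

lemma Phi_class_closed: "p \<in> carrier (sym_alg N) \<Longrightarrow> Phi_class N p \<in> carrier (Phi N)"
  using ring_hom_closed[OF Phi_class_hom] by fastforce

lemma Phi_class_of_sq_ideal: "p \<in> sq_ideal N \<Longrightarrow> Phi_class N p = \<zero>\<^bsub>Phi N\<^esub>"
  unfolding Phi_def Phi_class_def FactRing_def
  using ring.a_rcos_zero[OF cring.axioms(1)[OF sym_alg_cring] sq_ideal_is_ideal] by simp

lemma Phi_class_0: "Phi_class N 0 = \<zero>\<^bsub>Phi N\<^esub>"
  using ring_hom_zero[OF Phi_class_hom cring.axioms(1)[OF sym_alg_cring] cring.axioms(1)[OF Phi_cring]]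
  by simp

lemma Phi_class_power_in_subring:
  assumes "subring K (Phi N)" "p \<in> carrier (sym_alg N)" "Phi_class N p \<in> K"
  shows "Phi_class N (p ^ k) \<in> K"
  using assms(3) subringE(3,6)[OF assms(1)]
  by (induction k) (simp_all add: Phi_class_one Phi_class_mult assms(2) sym_alg_power)

text \<open>Equality in \<open>Phi N\<close>, with carrier membership built in so that congruences
  add and multiply without side conditions.\<close>

definition sq_cong :: "nat \<Rightarrow> cpoly \<Rightarrow> cpoly \<Rightarrow> bool" where
  "sq_cong N p q \<longleftrightarrow>
     p \<in> carrier (sym_alg N) \<and> q \<in> carrier (sym_alg N) \<and> Phi_class N p = Phi_class N q"

lemma sq_cong_refl: "p \<in> carrier (sym_alg N) \<Longrightarrow> sq_cong N p p"
  by (simp add: sq_cong_def)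

lemma sq_cong_trans [trans]: "sq_cong N p q \<Longrightarrow> sq_cong N q r \<Longrightarrow> sq_cong N p r"
  by (simp add: sq_cong_def)

lemma sq_cong_add: "sq_cong N p p' \<Longrightarrow> sq_cong N q q' \<Longrightarrow> sq_cong N (p + q) (p' + q')"
  by (simp add: sq_cong_def sym_alg_closed Phi_class_add)

lemma sq_cong_mult: "sq_cong N p p' \<Longrightarrow> sq_cong N q q' \<Longrightarrow> sq_cong N (p * q) (p' * q')"
  by (simp add: sq_cong_def sym_alg_closed Phi_class_mult)

lemma sq_cong_mult_zero:
  "p \<in> carrier (sym_alg N) \<Longrightarrow> sq_cong N q 0 \<Longrightarrow> sq_cong N (p * q) 0"
  using sq_cong_mult[OF sq_cong_refl, of p N q 0] by simp

lemma sq_cong_add_zero: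
  "p \<in> carrier (sym_alg N) \<Longrightarrow> sq_cong N q 0 \<Longrightarrow> sq_cong N (p + q) p"
  using sq_cong_add[OF sq_cong_refl, of p N q 0] by simp

lemma sq_cong_phi_square:
  assumes "i \<in> {1..N}"
  shows "sq_cong N (phi i * phi i) 0"
proof -
  have "phi i ^ 2 \<in> sq_ideal N"
    using assms ring.genideal_self[OF cring.axioms(1)[OF sym_alg_cring] sq_generators_closed]
    unfolding sq_ideal_def by blast
  from Phi_class_of_sq_ideal[OF this] show ?thesis
    using assms sym_alg_closed(4)[of 0 N]
    by (simp add: sq_cong_def sym_alg_closed Phi_class_0 power2_eq_square)
qed

text \<open>The binomial expansion stops after its linear term because \<open>y * y\<close> is zero
  modulo the squares.\<close>

lemma sq_cong_power_add:
  assumes Y: "Y \<in> carrier (sym_alg N)" and y: "y \<in> carrier (sym_alg N)" "sq_cong N (y * y) 0"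
  shows "sq_cong N ((Y + y) ^ Suc k) (Y ^ Suc k + cconst (of_nat (Suc k)) * Y ^ k * y)"
proof (induction k)
  case 0
  show ?case using Y y by (simp add: sq_cong_refl sym_alg_closed)
next
  case (Suc k)
  let ?c = "cconst (of_nat (Suc k))"
  note closed = Y y(1) sym_alg_closed sym_alg_power
  have "sq_cong N ((Y + y) * (Y + y) ^ Suc k) ((Y + y) * (Y ^ Suc k + ?c * Y ^ k * y))"
    by (intro sq_cong_mult Suc sq_cong_refl closed)
  also have "(Y + y) * (Y ^ Suc k + ?c * Y ^ k * y) =
      (Y ^ Suc (Suc k) + (?c + 1) * Y ^ Suc k * y) + (?c * Y ^ k) * (y * y)"
    by (simp add: algebra_simps)
  also have "sq_cong N \<dots> (Y ^ Suc (Suc k) + (?c + 1) * Y ^ Suc k * y)"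
    using sym_alg_closed(4)[of 1 N]
    by (intro sq_cong_add_zero sq_cong_mult_zero y(2) closed) simp
  also have "?c + 1 = cconst (of_nat (Suc (Suc k)))"
    using cconst_add[of "of_nat (Suc k)" 1] by (simp add: algebra_simps)
  finally show ?case by simp
qed

section \<open>Elementary symmetric polynomials in square-zero elements\<close>

definition elem_sym :: "nat \<Rightarrow> (nat \<Rightarrow> cpoly) \<Rightarrow> nat set \<Rightarrow> cpoly" where
  "elem_sym k y A = (\<Sum>I | I \<subseteq> A \<and> card I = k. \<Prod>i\<in>I. y i)"

lemma elem_sym_0: "finite A \<Longrightarrow> elem_sym 0 y A = 1"
proof -
  assume "finite A"
  then have "{I. I \<subseteq> A \<and> card I = 0} = {{}}" using finite_subset by fastforce
  then show ?thesis by (simp add: elem_sym_def)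
qed

lemma elem_sym_insert:
  assumes "finite A" "a \<notin> A"
  shows "elem_sym (Suc k) y (insert a A) = elem_sym (Suc k) y A + y a * elem_sym k y A"
proof -
  let ?S = "\<lambda>k. {I. I \<subseteq> A \<and> card I = k}"
  have fin: "finite (?S k)" for k using assms(1) by simp
  have mem: "finite I" "a \<notin> I" if "I \<in> ?S k" for I k
    using that assms finite_subset by auto
  have "{I. I \<subseteq> insert a A \<and> card I = Suc k} = ?S (Suc k) \<union> insert a ` ?S k"
  proof (intro equalityI subsetI)
    fix I assume I: "I \<in> {I. I \<subseteq> insert a A \<and> card I = Suc k}"
    then have finI: "finite I" using card_ge_0_finite[of I] by simp
    show "I \<in> ?S (Suc k) \<union> insert a ` ?S k"
    proof (cases "a \<in> I")
      case True
      then have "I = insert a (I - {a})" by blast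
      moreover have "I - {a} \<in> ?S k" using I True finI by auto
      ultimately show ?thesis by blast
    next
      case False
      then show ?thesis using I by auto
    qed
  next
    fix I assume "I \<in> ?S (Suc k) \<union> insert a ` ?S k"
    then show "I \<in> {I. I \<subseteq> insert a A \<and> card I = Suc k}"
    proof (elim UnE imageE)
      fix J assume J: "I = insert a J" "J \<in> ?S k"
      then show ?thesis using mem[OF J(2)] by auto
    qed auto
  qed
  moreover have "inj_on (insert a) (?S k)"
    by (rule inj_onI) (metis insert_ident mem(2))
  moreover have "?S (Suc k) \<inter> insert a ` ?S k = {}" using assms(2) by auto
  moreover have "(\<Sum>I\<in>?S k. \<Prod>i\<in>insert a I. y i) = (\<Sum>I\<in>?S k. y a * (\<Prod>i\<in>I. y i))"
    using mem by (intro sum.cong refl) (simp add: prod.insert)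
  ultimately show ?thesis
    using fin[of k] fin[of "Suc k"]
    by (simp add: elem_sym_def sum.union_disjoint sum.reindex sum_distrib_left)
qed

text \<open>Only products of distinct factors survive in the power, each in \<open>fact k\<close>
  orders. Thus powers of a generator of the algebra yield the homogeneous parts of the product of
  the \<open>1 + y i\<close>.\<close>

lemma power_sum_cong_elem_sym:
  assumes "finite A"
    and "\<And>i. i \<in> A \<Longrightarrow> y i \<in> carrier (sym_alg N)"
    and "\<And>i. i \<in> A \<Longrightarrow> sq_cong N (y i * y i) 0"
  shows "sq_cong N ((\<Sum>i\<in>A. y i) ^ k) (cconst (fact k) * elem_sym k y A)"
  using assms
proof (induction A arbitrary: k)
  case empty
  show ?case
  proof (cases k)
    case 0
    then show ?thesis using sym_alg_closed(4)[of 1 N] by (simp add: elem_sym_0 sq_cong_refl)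
  next
    case (Suc m)
    then have none: "{I. I \<subseteq> {} \<and> card I = k} = ({} :: nat set set)" by auto
    show ?thesis
      unfolding elem_sym_def none using Suc sym_alg_closed(4)[of 0 N] by (simp add: sq_cong_refl)
  qed
next
  case (insert a A)
  let ?Y = "\<Sum>i\<in>A. y i"
  have Y: "?Y \<in> carrier (sym_alg N)" using insert.prems by (intro sym_alg_sum) auto
  have a: "y a \<in> carrier (sym_alg N)" "sq_cong N (y a * y a) 0" using insert.prems by auto
  have IH: "sq_cong N (?Y ^ k) (cconst (fact k) * elem_sym k y A)" for k
    using insert by auto
  show ?case
  proof (cases k)
    case 0
    then show ?thesis
      using insert.hyps sym_alg_closed(4)[of 1 N] by (simp add: elem_sym_0 sq_cong_refl)
  next
    case (Suc m)
    let ?c = "cconst (of_nat (Suc m))"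
    have "sq_cong N ((?Y + y a) ^ Suc m) (?Y ^ Suc m + ?c * ?Y ^ m * y a)"
      by (rule sq_cong_power_add[OF Y a])
    also have "sq_cong N \<dots> (cconst (fact (Suc m)) * elem_sym (Suc m) y A +
        ?c * (cconst (fact m) * elem_sym m y A) * y a)"
      by (intro sq_cong_add sq_cong_mult IH sq_cong_refl a(1) sym_alg_closed(4))
    also have "?c * (cconst (fact m) * elem_sym m y A) * y a =
        cconst (fact (Suc m)) * (y a * elem_sym m y A)"
      by (simp only: fact_Suc cconst_mult mult_ac)
    finally show ?thesis
      using insert.hyps Suc by (simp add: elem_sym_insert algebra_simps)
  qed
qed

section \<open>Squarefree coefficients\<close>

definition sqfree :: "nat set \<Rightarrow> nat \<Rightarrow>\<^sub>0 nat" where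
  "sqfree I = (\<Sum>i\<in>I. Poly_Mapping.single i 1)"

lemma lookup_sqfree:
  "finite I \<Longrightarrow> Poly_Mapping.lookup (sqfree I) i = (if i \<in> I then 1 else 0)"
  by (simp add: sqfree_def lookup_sum lookup_single when_def)

lemma keys_sqfree: "finite I \<Longrightarrow> Poly_Mapping.keys (sqfree I) = I"
  by (auto simp: in_keys_iff lookup_sqfree split: if_splits)

lemma sqfree_inject: "finite I \<Longrightarrow> finite J \<Longrightarrow> sqfree I = sqfree J \<longleftrightarrow> I = J"
  by (metis keys_sqfree)

lemma prod_phi: "(\<Prod>i\<in>I. phi i) = Poly_Mapping.single (sqfree I) 1"
  by (induction I rule: infinite_finite_induct)
    (simp_all add: sqfree_def phi_def mult_single)

lemma cconst_mult_prod_phi: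
  "cconst a * (\<Prod>i\<in>I. phi i) = Poly_Mapping.single (sqfree I) a"
  by (simp add: prod_phi cconst_def mult_single)

lemma lookup_cconst_mult: "Poly_Mapping.lookup (cconst c * p) m = c * Poly_Mapping.lookup p m"
  for p :: cpoly
  by (simp add: cconst_def lookup_mult lookup_single when_mult)

text \<open>The polynomials all of whose monomials contain some square form an ideal
  \<open>J\<close>, and \<open>J\<close> contains the generators.\<close>

lemma sq_ideal_keys:
  assumes "p \<in> sq_ideal N" "m \<in> Poly_Mapping.keys p"
  shows "\<exists>i. Poly_Mapping.lookup m i \<ge> 2"
proof -
  interpret cring "sym_alg N" by (rule sym_alg_cring)
  define J where "J = {p \<in> carrier (sym_alg N).
    \<forall>m\<in>Poly_Mapping.keys p. \<exists>i. Poly_Mapping.lookup m i \<ge> 2}"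
  have mult: "p * q \<in> J" if "p \<in> J" "q \<in> carrier (sym_alg N)" for p q
  proof -
    have "\<exists>i. Poly_Mapping.lookup m i \<ge> 2" if m: "m \<in> Poly_Mapping.keys (p * q)" for m
    proof -
      obtain a b where ab: "m = a + b" "a \<in> Poly_Mapping.keys p"
        using m keys_mult[of p q] by blast
      then obtain i where "Poly_Mapping.lookup a i \<ge> 2" using \<open>p \<in> J\<close> by (auto simp: J_def)
      then show ?thesis using ab(1) by (intro exI[of _ i]) (simp add: lookup_add)
    qed
    then show ?thesis using that by (auto simp: J_def sym_alg_closed)
  qed
  have "ideal J (sym_alg N)"
  proof (rule idealI)
    show "subgroup J (add_monoid (sym_alg N))"
    proof (rule add.subgroupI)
      show "J \<subseteq> carrier (sym_alg N)" "J \<noteq> {}"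
        using sym_alg_closed(4)[of 0 N] by (auto simp: J_def intro!: exI[of _ 0])
    next
      fix p assume p: "p \<in> J"
      then have "- p = \<ominus>\<^bsub>sym_alg N\<^esub> p"
        by (intro sum_zero_eq_neg) (auto simp: J_def intro: sym_alg_closed)
      then show "\<ominus>\<^bsub>sym_alg N\<^esub> p \<in> J"
        using p sym_alg_closed(3)[of p N] by (simp add: J_def flip: \<open>- p = _\<close>)
    next
      fix p q assume "p \<in> J" "q \<in> J"
      then show "p \<oplus>\<^bsub>sym_alg N\<^esub> q \<in> J"
        using sym_alg_closed(1)[of p N q] Poly_Mapping.keys_add[of p q] by (auto simp: J_def)
    qed
  next
    fix p q assume "p \<in> J" "q \<in> carrier (sym_alg N)"
    then show "q \<otimes>\<^bsub>sym_alg N\<^esub> p \<in> J" "p \<otimes>\<^bsub>sym_alg N\<^esub> q \<in> J"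
      using mult by (simp_all add: mult.commute)
  qed (rule ring_axioms)
  moreover have "{phi i ^ 2 | i. i \<in> {1..N}} \<subseteq> J"
  proof -
    have "phi i ^ 2 = Poly_Mapping.single (Poly_Mapping.single i 2) 1" for i
      by (simp add: phi_def power2_eq_square mult_single numeral_2_eq_2 flip: single_add)
    then have "\<forall>m\<in>Poly_Mapping.keys (phi i ^ 2). \<exists>j. Poly_Mapping.lookup m j \<ge> 2" for i
      by (auto intro: exI[of _ i])
    then show ?thesis using sq_generators_closed[of N] unfolding J_def by blast
  qed
  ultimately have "sq_ideal N \<subseteq> J"
    unfolding sq_ideal_def by (rule genideal_minimal)
  then show ?thesis using assms by (auto simp: J_def)
qed

text \<open>Representatives differ by an element of the ideal, which has no squarefree monomials.
  Squarefree coefficients are therefore functions of the class, and they separate the basis elements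
  below.\<close>

lemma Phi_class_eq_lookup_sqfree:
  assumes "p \<in> carrier (sym_alg N)" "q \<in> carrier (sym_alg N)" "Phi_class N p = Phi_class N q"
    and "finite I"
  shows "Poly_Mapping.lookup p (sqfree I) = Poly_Mapping.lookup q (sqfree I)"
proof -
  interpret ideal "sq_ideal N" "sym_alg N" by (rule sq_ideal_is_ideal)
  have "p \<in> sq_ideal N +>\<^bsub>sym_alg N\<^esub> q"
    using a_rcos_self[OF assms(1)] assms(3) by (simp add: Phi_class_def)
  then obtain h where h: "h \<in> sq_ideal N" "p = h + q"
    by (auto simp: a_r_coset_def')
  have "sqfree I \<notin> Poly_Mapping.keys h"
  proof
    assume "sqfree I \<in> Poly_Mapping.keys h"
    from sq_ideal_keys[OF h(1) this] obtain i where "Poly_Mapping.lookup (sqfree I) i \<ge> 2" ..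
    then show False using assms(4) by (simp add: lookup_sqfree split: if_splits)
  qed
  then show ?thesis using h(2) by (simp add: lookup_add in_keys_iff)
qed

lemma homogeneous_sum:
  assumes "\<And>i. i \<in> A \<Longrightarrow> homogeneous k (f i)"
  shows "homogeneous k (\<Sum>i\<in>A. f i)"
  using assms keys_sum[of f A] unfolding homogeneous_def by blast

lemma homogeneous_single_sqfree:
  assumes "finite I" "a \<noteq> 0 \<Longrightarrow> card I = k"
  shows "homogeneous k (Poly_Mapping.single (sqfree I) a)"
  using assms by (simp add: homogeneous_def keys_sqfree lookup_sqfree)

section \<open>A homogeneous basis of the algebra\<close>

text \<open>The algebra depends on the vectors only through their coordinate space; here that space
  is an arbitrary \<open>U\<close>.\<close>

definition generated_alg :: "nat \<Rightarrow> (nat \<Rightarrow> complex) set \<Rightarrow> cpoly set set" where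
  "generated_alg N U = generate_ring (Phi N)
     (Phi_scalars N \<union> Phi_class N ` {\<Sum>i = 1..N. cconst (x i) * phi i | x. x \<in> U})"

locale coordinates =
  fixes N :: nat and U :: "(nat \<Rightarrow> complex) set"
  assumes U: "function_space U"
begin

text \<open>A choice of straightening coefficients. By independence of the products their values on
  \<open>indeps U N\<close> are in fact unique.\<close>

definition coeff :: "nat set \<Rightarrow> nat set \<Rightarrow> complex" where
  "coeff I = (SOME c. (\<forall>S. card (inactive U N S) \<noteq> card I \<longrightarrow> c S = 0) \<and>
    (\<forall>x\<in>U. (\<Prod>i\<in>I. x i) = (\<Sum>S\<in>indeps U N. c S * (\<Prod>i\<in>inactive U N S. x i))))"

lemma
  assumes "I \<subseteq> {1..N}"
  shows coeff_eq_0: "card (inactive U N S) \<noteq> card I \<Longrightarrow> coeff I S = 0"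
    and coeff_expand: "x \<in> U \<Longrightarrow>
      (\<Prod>i\<in>I. x i) = (\<Sum>S\<in>indeps U N. coeff I S * (\<Prod>i\<in>inactive U N S. x i))"
  using someI_ex[OF straightening[OF U assms]] unfolding coeff_def by blast+

text \<open>The product over \<open>inactive U N T\<close> is its own expansion, and independence
  forces the chosen coefficients to agree with it.\<close>

lemma coeff_inactive:
  assumes "S \<in> indeps U N" "T \<in> indeps U N"
  shows "coeff (inactive U N T) S = (if S = T then 1 else 0)"
proof -
  let ?d = "\<lambda>S. coeff (inactive U N T) S - (if S = T then 1 else 0)"
  have "\<forall>S\<in>indeps U N. ?d S = 0"
  proof (rule inactive_products_independent[OF U])
    fix x assume x: "x \<in> U"
    have "(\<Sum>S\<in>indeps U N. (if S = T then 1 else 0) * (\<Prod>i\<in>inactive U N S. x i)) =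
        (\<Prod>i\<in>inactive U N T. x i)"
      using assms(2) finite_indeps[of U N]
      by (simp add: if_distrib[of "\<lambda>c. c * _"] cong: if_cong)
    then show "(\<Sum>S\<in>indeps U N. ?d S * (\<Prod>i\<in>inactive U N S. x i)) = 0"
      using coeff_expand[OF inactive_subset[of U N T] x]
      by (simp add: left_diff_distrib sum_subtractf)
  qed
  then show ?thesis using assms(1) by auto
qed

text \<open>The column of the straightening matrix at \<open>S\<close>: the product of all
  \<open>1 + x i phi i\<close> is the combination of the \<open>basis_elem S\<close> with
  coefficients \<open>eval_prod x S\<close>.\<close>

definition basis_elem :: "nat set \<Rightarrow> cpoly" where
  "basis_elem S = (\<Sum>I\<in>Pow {1..N}. cconst (coeff I S) * (\<Prod>i\<in>I. phi i))"

definition comb :: "nat set set \<Rightarrow> (nat set \<Rightarrow> complex) \<Rightarrow> cpoly" where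
  "comb Q a = (\<Sum>S\<in>Q. cconst (a S) * basis_elem S)"

abbreviation eval_prod :: "(nat \<Rightarrow> complex) \<Rightarrow> nat set \<Rightarrow> complex" where
  "eval_prod x S \<equiv> (\<Prod>i\<in>inactive U N S. x i)"

lemma basis_elem_closed: "basis_elem S \<in> carrier (sym_alg N)"
  unfolding basis_elem_def
  by (intro sym_alg_sum sym_alg_closed(2) sym_alg_prod sym_alg_closed(4,5)) auto

lemma comb_closed: "comb Q a \<in> carrier (sym_alg N)"
  unfolding comb_def by (intro sym_alg_sum sym_alg_closed(2) sym_alg_closed(4) basis_elem_closed)

lemma comb_add_mult: "comb Q (\<lambda>S. a S + c * b S) = comb Q a + cconst c * comb Q b"
  by (simp add: comb_def cconst_add cconst_mult sum.distrib sum_distrib_left algebra_simps)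

lemma homogeneous_basis_elem:
  "homogeneous (card (inactive U N S)) (basis_elem S)"
  unfolding basis_elem_def
proof (rule homogeneous_sum)
  fix I assume I: "I \<in> Pow {1..N}"
  then have "finite I" using finite_subset by auto
  then show "homogeneous (card (inactive U N S)) (cconst (coeff I S) * (\<Prod>i\<in>I. phi i))"
    unfolding cconst_mult_prod_phi using coeff_eq_0[of I S] I
    by (metis PowD homogeneous_single_sqfree)
qed

lemma lookup_basis_elem:
  assumes "J \<subseteq> {1..N}"
  shows "Poly_Mapping.lookup (basis_elem S) (sqfree J) = coeff J S"
proof -
  have inject: "sqfree I = sqfree J \<longleftrightarrow> I = J" if "I \<in> Pow {1..N}" for I
    using that assms by (intro sqfree_inject) (auto intro: finite_subset)
  have "Poly_Mapping.lookup (basis_elem S) (sqfree J) =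
      (\<Sum>I\<in>Pow {1..N}. if I = J then coeff I S else 0)"
    unfolding basis_elem_def cconst_mult_prod_phi lookup_sum
    by (intro sum.cong refl) (simp only: lookup_single when_def inject)
  then show ?thesis using assms by simp
qed

lemma lookup_comb:
  assumes "Q \<subseteq> indeps U N" "T \<in> indeps U N"
  shows "Poly_Mapping.lookup (comb Q a) (sqfree (inactive U N T)) = (if T \<in> Q then a T else 0)"
proof -
  have fin: "finite Q" using assms(1) finite_indeps finite_subset by blast
  have "Poly_Mapping.lookup (comb Q a) (sqfree (inactive U N T)) =
      (\<Sum>S\<in>Q. if S = T then a S else 0)"
    unfolding comb_def lookup_sum lookup_cconst_mult lookup_basis_elem[OF inactive_subset]
    by (intro sum.cong refl) (simp add: coeff_inactive[OF subsetD[OF assms(1)] assms(2)])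
  then show ?thesis using fin by simp
qed

text \<open>Any representative \<open>p\<close> reveals the coefficients of the combination, since
  the squarefree monomials on the inactive sets are dual to the basis elements.\<close>

lemma Phi_class_comb_eq:
  assumes "Q \<subseteq> indeps U N" "T \<in> indeps U N" "p \<in> carrier (sym_alg N)"
    and "Phi_class N (comb Q a) = Phi_class N p"
  shows "Poly_Mapping.lookup p (sqfree (inactive U N T)) = (if T \<in> Q then a T else 0)"
  using Phi_class_eq_lookup_sqfree[OF comb_closed assms(3,4), of "inactive U N T"]
    lookup_comb[OF assms(1,2), of a] by simp

lemma dimension_span_basis_elem:
  assumes "Q \<subseteq> indeps U N"
  shows "ring.dimension (Phi N) (card Q) (Phi_scalars N) {Phi_class N (comb Q a) | a. True}"
proof -
  interpret P: cring "Phi N" by (rule Phi_cring)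
  have "finite Q" using assms finite_indeps finite_subset by blast
  then show ?thesis
    using assms
  proof (induction Q)
    case empty
    show ?case using P.zero_dim by (simp add: comb_def Phi_class_0)
  next
    case (insert S Q)
    let ?E = "{Phi_class N (comb Q a) | a. True}"
    have sum: "comb (insert S Q) a = cconst (a S) * basis_elem S + comb Q a" for a
      using insert.hyps by (simp add: comb_def)
    have cls: "Phi_class N (comb (insert S Q) a) =
      Phi_class N (cconst (a S)) \<otimes>\<^bsub>Phi N\<^esub> Phi_class N (basis_elem S) \<oplus>\<^bsub>Phi N\<^esub> Phi_class N (comb Q a)"
      for a
      unfolding sum by (simp add: Phi_class_add Phi_class_mult sym_alg_closed basis_elem_closed comb_closed)
    have upd: "comb Q (a(S := c)) = comb Q a" for a c
      using insert.hyps unfolding comb_def by (intro sum.cong) auto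
    \<comment> \<open>At the squarefree monomial on \<open>inactive U N S\<close> the new element
      has coefficient 1, while all combinations over \<open>Q\<close> have 0.\<close>
    have notin: "Phi_class N (basis_elem S) \<notin> ?E"
    proof
      assume "Phi_class N (basis_elem S) \<in> ?E"
      then obtain a where "Phi_class N (comb Q a) = Phi_class N (basis_elem S)" by auto
      from Phi_class_comb_eq[OF _ _ basis_elem_closed this, of S] show False
        using insert.hyps insert.prems lookup_basis_elem[OF inactive_subset[of U N S], of S]
        by (simp add: coeff_inactive)
    qed
    have "P.line_extension (Phi_scalars N) (Phi_class N (basis_elem S)) ?E =
        {Phi_class N (comb (insert S Q) a) | a. True}" (is "?L = ?R")
    proof (intro equalityI subsetI)
      fix u assume "u \<in> ?L"
      then obtain c a where "u = Phi_class N (cconst c) \<otimes>\<^bsub>Phi N\<^esub> Phi_class N (basis_elem S)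
          \<oplus>\<^bsub>Phi N\<^esub> Phi_class N (comb Q a)"
        by (auto simp: P.line_extension_mem_iff Phi_scalars_def)
      then have "u = Phi_class N (comb (insert S Q) (a(S := c)))" by (simp add: cls upd)
      then show "u \<in> ?R" by blast
    next
      fix u assume "u \<in> ?R"
      then show "u \<in> ?L" by (auto simp: P.line_extension_mem_iff Phi_scalars_def cls)
    qed
    moreover have "P.dimension (Suc (card Q)) (Phi_scalars N)
        (P.line_extension (Phi_scalars N) (Phi_class N (basis_elem S)) ?E)"
      using insert by (intro P.Suc_dim notin Phi_class_closed basis_elem_closed) auto
    ultimately show ?case using insert.hyps by simp
  qed
qed

section \<open>Expansion in the basis elements\<close>

text \<open>Straightening preserves the degree, so a weight \<open>g\<close> of the degree passes
  from \<open>I\<close> to the inactive set. The constant weight gives the full product, an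
  indicator gives one homogeneous part.\<close>

lemma expand_products:
  assumes x: "x \<in> U"
  shows "(\<Sum>I\<in>Pow {1..N}. cconst (g (card I)) * (\<Prod>i\<in>I. cconst (x i) * phi i)) =
    comb (indeps U N) (\<lambda>S. g (card (inactive U N S)) * eval_prod x S)"
proof -
  have expand: "cconst (g (card I)) * (\<Prod>i\<in>I. cconst (x i) * phi i) =
      (\<Sum>S\<in>indeps U N. cconst (g (card (inactive U N S)) * eval_prod x S) *
        (cconst (coeff I S) * (\<Prod>i\<in>I. phi i)))" if I: "I \<in> Pow {1..N}" for I
  proof -
    have "g (card I) * (\<Prod>i\<in>I. x i) =
        (\<Sum>S\<in>indeps U N. g (card (inactive U N S)) * eval_prod x S * coeff I S)"
      unfolding coeff_expand[OF PowD[OF I] x] sum_distrib_left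
    proof (intro sum.cong refl)
      fix S
      show "g (card I) * (coeff I S * eval_prod x S) =
          g (card (inactive U N S)) * eval_prod x S * coeff I S"
        by (cases "card (inactive U N S) = card I") (simp_all add: coeff_eq_0[OF PowD[OF I]])
    qed
    then have "cconst (g (card I) * (\<Prod>i\<in>I. x i)) =
        (\<Sum>S\<in>indeps U N. cconst (g (card (inactive U N S)) * eval_prod x S * coeff I S))"
      by (simp add: cconst_sum)
    then have "cconst (g (card I) * (\<Prod>i\<in>I. x i)) * (\<Prod>i\<in>I. phi i) =
        (\<Sum>S\<in>indeps U N. cconst (g (card (inactive U N S)) * eval_prod x S) *
          (cconst (coeff I S) * (\<Prod>i\<in>I. phi i)))"
      by (simp add: sum_distrib_right cconst_mult mult.assoc)
    then show ?thesis
      by (simp add: cconst_mult cconst_prod prod.distrib mult.assoc)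
  qed
  show ?thesis
    unfolding comb_def basis_elem_def
    by (simp only: expand cong: sum.cong) (subst sum.swap, simp only: sum_distrib_left)
qed

lemma elem_sym_comb:
  assumes "x \<in> U"
  shows "elem_sym k (\<lambda>i. cconst (x i) * phi i) {1..N} =
    comb (indeps U N) (\<lambda>S. (if card (inactive U N S) = k then 1 else 0) * eval_prod x S)"
proof -
  have "elem_sym k (\<lambda>i. cconst (x i) * phi i) {1..N} =
      (\<Sum>I\<in>{I\<in>Pow {1..N}. card I = k}. \<Prod>i\<in>I. cconst (x i) * phi i)"
    unfolding elem_sym_def by (intro sum.cong) auto
  also have "\<dots> = (\<Sum>I\<in>Pow {1..N}. cconst (if card I = k then 1 else 0) * (\<Prod>i\<in>I. cconst (x i) * phi i))"
    by (subst sum.inter_filter) (auto intro!: sum.cong)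
  finally show ?thesis using expand_products[OF assms, of "\<lambda>n. if n = k then 1 else 0"] by simp
qed

lemma product_comb:
  assumes "x \<in> U"
  shows "(\<Prod>i\<in>{1..N}. 1 + cconst (x i) * phi i) = comb (indeps U N) (eval_prod x)"
proof -
  have "(\<Prod>i\<in>{1..N}. 1 + cconst (x i) * phi i) =
      (\<Sum>I\<in>Pow {1..N}. \<Prod>i\<in>I. cconst (x i) * phi i)"
    using prod_add[of "{1..N}" "\<lambda>i. cconst (x i) * phi i" "\<lambda>_. 1"] by (simp add: add.commute)
  then show ?thesis using expand_products[OF assms, of "\<lambda>_. 1"] by simp
qed

text \<open>The exponential law: \<open>phi i\<close> has square zero, so the cross term in each
  factor disappears.\<close>

lemma product_cong:
  assumes "A \<subseteq> {1..N}"
  shows "sq_cong N ((\<Prod>i\<in>A. 1 + cconst (x i) * phi i) * (\<Prod>i\<in>A. 1 + cconst (y i) * phi i))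
    (\<Prod>i\<in>A. 1 + cconst (x i + y i) * phi i)"
proof -
  have "finite A" using assms finite_subset by blast
  then show ?thesis
    using assms
  proof (induction A)
    case empty
    show ?case using sym_alg_closed(4)[of 1 N] by (simp add: sq_cong_refl)
  next
    case (insert a A)
    let ?f = "\<lambda>x a. 1 + cconst (x a) * phi a"
    have a: "a \<in> {1..N}" using insert.prems by simp
    have fclosed: "?f x a \<in> carrier (sym_alg N)" for x
      using a sym_alg_closed(4)[of 1 N] by (simp add: sym_alg_closed)
    have "?f x a * ?f y a = ?f (\<lambda>i. x i + y i) a + cconst (x a * y a) * (phi a * phi a)"
      by (simp add: cconst_add cconst_mult algebra_simps)
    then have "sq_cong N (?f x a * ?f y a) (?f (\<lambda>i. x i + y i) a)"
      using fclosed[of "\<lambda>i. x i + y i"]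
      by (simp only:) (intro sq_cong_add_zero sq_cong_mult_zero sq_cong_phi_square a sym_alg_closed(4))
    then have "sq_cong N ((?f x a * ?f y a) * ((\<Prod>i\<in>A. ?f x i) * (\<Prod>i\<in>A. ?f y i)))
        (?f (\<lambda>i. x i + y i) a * (\<Prod>i\<in>A. ?f (\<lambda>i. x i + y i) i))"
      using insert by (intro sq_cong_mult) auto
    then show ?case using insert.hyps by (simp add: mult_ac)
  qed
qed

section \<open>The generated algebra as a span\<close>

text \<open>\<open>evaluations_span\<close> as an induction rule for coefficient functions. It
  controls them only on \<open>indeps U N\<close>, hence the last assumption on
  \<open>W\<close>.\<close>

lemma all_functionals:
  assumes "function_space W" "\<And>x. x \<in> U \<Longrightarrow> eval_prod x \<in> W"
    and "\<And>a b. a \<in> W \<Longrightarrow> (\<And>S. S \<in> indeps U N \<Longrightarrow> a S = b S) \<Longrightarrow> b \<in> W"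
  shows "b \<in> W"
proof -
  have "\<exists>w\<in>W. \<forall>S\<in>indeps U N. w S = b S"
    using finite_indeps inactive_products_independent[OF U] assms(1,2)
    by (rule evaluations_span[of _ U "\<lambda>S x. eval_prod x S"])
  then show ?thesis using assms(3) by blast
qed

abbreviation span_class :: "(nat set \<Rightarrow> complex) \<Rightarrow> cpoly set" where
  "span_class a \<equiv> Phi_class N (comb (indeps U N) a)"

lemma span_class_cong: "(\<And>S. S \<in> indeps U N \<Longrightarrow> a S = b S) \<Longrightarrow> span_class a = span_class b"
  unfolding comb_def by (simp cong: sum.cong)

lemma span_class_add_mult:
  "span_class (\<lambda>S. a S + c * b S) =
    span_class a \<oplus>\<^bsub>Phi N\<^esub> Phi_class N (cconst c) \<otimes>\<^bsub>Phi N\<^esub> span_class b"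
  unfolding comb_add_mult by (simp add: Phi_class_add Phi_class_mult sym_alg_closed comb_closed)

lemma span_class_zero: "span_class (\<lambda>_. 0) = \<zero>\<^bsub>Phi N\<^esub>"
  by (simp add: comb_def Phi_class_0)

lemma generators_closed:
  "Phi_scalars N \<union> Phi_class N ` {\<Sum>i = 1..N. cconst (x i) * phi i | x. x \<in> U} \<subseteq> carrier (Phi N)"
proof -
  have "(\<Sum>i = 1..N. cconst (x i) * phi i) \<in> carrier (sym_alg N)" for x
    by (intro sym_alg_sum sym_alg_closed(2) sym_alg_closed(4,5))
  then show ?thesis
    unfolding Phi_scalars_def using sym_alg_closed(4) by (auto intro: Phi_class_closed)
qed

lemma subring_generated_alg: "subring (generated_alg N U) (Phi N)"
  unfolding generated_alg_def
  by (rule ring.generate_ring_is_subring[OF cring.axioms(1)[OF Phi_cring] generators_closed])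

text \<open>It suffices to treat the evaluations. Their homogeneous parts are the powers of the
  generator \<open>?l\<close> divided by factorials.\<close>

lemma span_class_in_generated: "span_class b \<in> generated_alg N U"
proof -
  note sub = subring_generated_alg
  have scalar: "Phi_class N (cconst c) \<in> generated_alg N U" for c
    unfolding generated_alg_def by (rule generate_ring.incl) (simp add: Phi_scalars_def)
  let ?W = "{w. span_class w \<in> generated_alg N U}"
  have W: "function_space ?W"
    unfolding function_space_def
    using subringE(2,6,7)[OF sub] scalar by (simp add: span_class_add_mult span_class_zero)
  have eval: "eval_prod x \<in> ?W" if x: "x \<in> U" for x
  proof -
    let ?y = "\<lambda>i. cconst (x i) * phi i"
    let ?a = "\<lambda>k S. (if card (inactive U N S) = k then 1 else 0) * eval_prod x S"
    let ?l = "\<Sum>i\<in>{1..N}. ?y i"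
    have y: "?y i \<in> carrier (sym_alg N)" if "i \<in> {1..N}" for i
      using that by (intro sym_alg_closed)
    have l: "?l \<in> carrier (sym_alg N)" using y by (rule sym_alg_sum)
    have "Phi_class N ?l \<in> generated_alg N U"
      unfolding generated_alg_def using x by (intro generate_ring.incl) auto
    then have power: "Phi_class N (?l ^ k) \<in> generated_alg N U" for k
      by (rule Phi_class_power_in_subring[OF sub l])
    have "?a k \<in> ?W" for k
    proof -
      have sq: "sq_cong N (?y i * ?y i) 0" if "i \<in> {1..N}" for i
      proof -
        have "sq_cong N (cconst (x i * x i) * (phi i * phi i)) 0"
          using that by (intro sq_cong_mult_zero sq_cong_phi_square sym_alg_closed(4))
        then show ?thesis by (simp add: cconst_mult mult_ac)
      qed
      have "sq_cong N (?l ^ k) (cconst (fact k) * comb (indeps U N) (?a k))"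
        unfolding elem_sym_comb[OF x, symmetric]
        by (rule power_sum_cong_elem_sym[OF finite_atLeastAtMost y sq])
      from sq_cong_mult[OF sq_cong_refl[OF sym_alg_closed(4)] this, of "inverse (fact k)"]
      have "sq_cong N (cconst (inverse (fact k)) * ?l ^ k) (comb (indeps U N) (?a k))"
        by (simp flip: mult.assoc cconst_mult)
      then have "span_class (?a k) = Phi_class N (cconst (inverse (fact k))) \<otimes>\<^bsub>Phi N\<^esub> Phi_class N (?l ^ k)"
        unfolding sq_cong_def Phi_class_mult[OF sym_alg_closed(4) sym_alg_power[OF l]] by simp
      then show ?thesis using subringE(6)[OF sub scalar power] by simp
    qed
    \<comment> \<open>Inactive sets have at most \<open>N\<close> elements, so these degrees exhaust
      the evaluation.\<close>
    then have "(\<lambda>S. \<Sum>k\<le>N. 1 * ?a k S) \<in> ?W"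
      by (intro function_space_sum W) auto
    moreover have "(\<Sum>k\<le>N. 1 * ?a k S) = eval_prod x S" for S
    proof -
      have "card (inactive U N S) \<le> N" using card_mono[OF _ inactive_subset[of U N S]] by simp
      then show ?thesis by (simp flip: sum_distrib_right)
    qed
    ultimately show ?thesis by simp
  qed
  have "b \<in> ?W"
  proof (rule all_functionals[OF W eval])
    fix a b assume "a \<in> ?W" "\<And>S. S \<in> indeps U N \<Longrightarrow> a S = b S"
    then show "b \<in> ?W" using span_class_cong[of a b] by simp
  qed
  then show ?thesis by simp
qed

text \<open>By the exponential law the product of two evaluations is the evaluation at the sum.
  Linearity extends this to one factor at a time.\<close>

lemma span_class_mult_closed:
  "\<exists>c. span_class a \<otimes>\<^bsub>Phi N\<^esub> span_class b = span_class c"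
proof -
  interpret P: cring "Phi N" by (rule Phi_cring)
  have carr: "span_class a \<in> carrier (Phi N)" for a by (rule Phi_class_closed[OF comb_closed])
  have scal: "Phi_class N (cconst c) \<in> carrier (Phi N)" for c
    by (rule Phi_class_closed[OF sym_alg_closed(4)])
  let ?W = "\<lambda>a. {w. \<exists>c. span_class a \<otimes>\<^bsub>Phi N\<^esub> span_class w = span_class c}"
  have W: "function_space (?W a)" for a
    unfolding function_space_def
  proof (safe)
    show "\<exists>c. span_class a \<otimes>\<^bsub>Phi N\<^esub> span_class (\<lambda>_. 0) = span_class c"
      using carr by (intro exI[of _ "\<lambda>_. 0"]) (simp add: span_class_zero)
  next
    fix v w :: "nat set \<Rightarrow> complex" and r c d
    assume c: "span_class a \<otimes>\<^bsub>Phi N\<^esub> span_class v = span_class c"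
      and d: "span_class a \<otimes>\<^bsub>Phi N\<^esub> span_class w = span_class d"
    have "span_class a \<otimes>\<^bsub>Phi N\<^esub> span_class (\<lambda>S. v S + r * w S) = span_class (\<lambda>S. c S + r * d S)"
      unfolding span_class_add_mult using carr scal
      by (simp add: P.r_distr P.m_lcomm flip: c d)
    then show "\<exists>c. span_class a \<otimes>\<^bsub>Phi N\<^esub> span_class (\<lambda>S. v S + r * w S) = span_class c" by blast
  qed
  have W_cong: "w' \<in> ?W a" if "w \<in> ?W a" "\<And>S. S \<in> indeps U N \<Longrightarrow> w S = w' S" for w w' a
    using that(1) span_class_cong[OF that(2)] by simp
  have eval: "eval_prod y \<in> ?W (eval_prod x)" if "x \<in> U" "y \<in> U" for x y
  proof -
    have xy: "(\<lambda>i. x i + y i) \<in> U" using U that by (rule function_space_add)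
    have "span_class (eval_prod x) \<otimes>\<^bsub>Phi N\<^esub> span_class (eval_prod y) =
        span_class (eval_prod (\<lambda>i. x i + y i))"
      using product_cong[OF subset_refl, of x y]
      unfolding product_comb[OF that(1)] product_comb[OF that(2)] product_comb[OF xy]
      by (simp add: sq_cong_def Phi_class_mult comb_closed)
    then show ?thesis by blast
  qed
  \<comment> \<open>First the right factor becomes arbitrary; commutativity then lets the same rule
    free the left one.\<close>
  have left: "b \<in> ?W (eval_prod x)" if "x \<in> U" for x b
    by (rule all_functionals[OF W eval[OF that] W_cong])
  have "a \<in> ?W b"
  proof (rule all_functionals[OF W _ W_cong])
    fix x assume "x \<in> U"
    then show "eval_prod x \<in> ?W b" using left[of x b] P.m_comm[OF carr carr] by simp
  qed
  then show ?thesis using P.m_comm[OF carr carr] by simp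
qed

text \<open>The span is a subring containing the generators, hence contains the algebra; the other
  inclusion is \<open>span_class_in_generated\<close>.\<close>

lemma generated_alg_eq: "generated_alg N U = {span_class a | a. True}"
proof
  interpret P: cring "Phi N" by (rule Phi_cring)
  let ?X = "{span_class a | a. True}"
  have scalar: "Phi_class N (cconst c) \<in> ?X" for c
  proof -
    \<comment> \<open>For \<open>x = 0\<close> the product of the \<open>1 + x i phi i\<close> is 1.
      The shape \<open>0 + c * _\<close> fits \<open>comb_add_mult\<close>.\<close>
    have "comb (indeps U N) (\<lambda>S. 0 + c * eval_prod (\<lambda>_. 0) S) = cconst c"
      unfolding comb_add_mult product_comb[OF function_space_zero[OF U], symmetric]
      by (simp add: comb_def)
    then show ?thesis by (metis (mono_tags, lifting) mem_Collect_eq)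
  qed
  have neg: "\<ominus>\<^bsub>Phi N\<^esub> span_class a = span_class (\<lambda>S. 0 + -1 * a S)" for a
  proof (rule P.minus_equality)
    have "span_class (\<lambda>S. (0 + -1 * a S) + 1 * a S) = span_class (\<lambda>S. 0 + -1 * a S) \<oplus>\<^bsub>Phi N\<^esub> span_class a"
      unfolding span_class_add_mult[of _ 1] using Phi_class_closed[OF comb_closed]
      by (simp add: Phi_class_one)
    then show "span_class (\<lambda>S. 0 + -1 * a S) \<oplus>\<^bsub>Phi N\<^esub> span_class a = \<zero>\<^bsub>Phi N\<^esub>"
      by (simp add: span_class_zero)
  qed (rule Phi_class_closed[OF comb_closed])+
  have "subring ?X (Phi N)"
  proof (rule P.subringI)
    show "?X \<subseteq> carrier (Phi N)" using Phi_class_closed[OF comb_closed] by auto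
    show "\<one>\<^bsub>Phi N\<^esub> \<in> ?X" using scalar[of 1] by (simp add: Phi_class_one)
    show "\<ominus>\<^bsub>Phi N\<^esub> u \<in> ?X" if "u \<in> ?X" for u using that neg by blast
    show "u \<otimes>\<^bsub>Phi N\<^esub> w \<in> ?X" if "u \<in> ?X" "w \<in> ?X" for u w
      using that span_class_mult_closed by auto
    show "u \<oplus>\<^bsub>Phi N\<^esub> w \<in> ?X" if uw: "u \<in> ?X" "w \<in> ?X" for u w
    proof -
      obtain a b where "u = span_class a" "w = span_class b" using uw by blast
      then have "u \<oplus>\<^bsub>Phi N\<^esub> w = span_class (\<lambda>S. a S + 1 * b S)"
        unfolding span_class_add_mult using Phi_class_closed[OF comb_closed]
        by (simp add: Phi_class_one)
      then show ?thesis by blast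
    qed
  qed
  moreover have "Phi_class N (\<Sum>i = 1..N. cconst (x i) * phi i) \<in> ?X" if "x \<in> U" for x
  proof -
    let ?y = "\<lambda>i. cconst (x i) * phi i"
    \<comment> \<open>A generator is the degree 1 part of the evaluation at
      \<open>x\<close>.\<close>
    have "elem_sym 1 ?y A = (\<Sum>i\<in>A. ?y i)" if "finite A" for A
      using that by (induction A)
        (simp_all add: elem_sym_insert elem_sym_0 add.commute, simp add: elem_sym_def)
    from this[of "{1..N}"] show ?thesis using elem_sym_comb[OF that, of 1] by auto
  qed
  ultimately show "generated_alg N U \<subseteq> ?X"
    unfolding generated_alg_def using scalar
    by (intro P.generate_ring_min_subring1 generators_closed) (auto simp: Phi_scalars_def)
  show "?X \<subseteq> generated_alg N U" using span_class_in_generated by blast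
qed

text \<open>The homogeneous representative \<open>p\<close> of a class may differ from the
  combination representing it, but the squarefree coefficients agree, so every \<open>a S\<close> of
  the wrong degree is zero. Conversely, the basis elements are homogeneous.\<close>

lemma generated_alg_Phi_comp:
  "generated_alg N U \<inter> Phi_comp N k =
    {Phi_class N (comb {S \<in> indeps U N. card (inactive U N S) = k} a) | a. True}"
proof (intro equalityI subsetI)
  let ?Q = "{S \<in> indeps U N. card (inactive U N S) = k}"
  {
    fix u assume "u \<in> generated_alg N U \<inter> Phi_comp N k"
    then obtain a p where a: "u = span_class a" and p: "p \<in> carrier (sym_alg N)"
      "homogeneous k p" "u = Phi_class N p"
      unfolding generated_alg_eq Phi_comp_def by blast
    have "a S = 0" if "S \<in> indeps U N" "card (inactive U N S) \<noteq> k" for S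
    proof -
      have "sqfree (inactive U N S) \<notin> Poly_Mapping.keys p"
        using p(2) that(2) by (auto simp: homogeneous_def keys_sqfree lookup_sqfree)
      then show ?thesis
        using Phi_class_comb_eq[OF subset_refl that(1) p(1), of a] a p(3) that(1)
        by (simp add: in_keys_iff)
    qed
    then have "comb (indeps U N) a = comb ?Q a"
      unfolding comb_def by (intro sum.mono_neutral_right) (auto simp: finite_indeps)
    then show "u \<in> {Phi_class N (comb ?Q a) | a. True}" using a by auto
  next
    fix u assume "u \<in> {Phi_class N (comb ?Q a) | a. True}"
    then obtain a where u: "u = Phi_class N (comb ?Q a)" by blast
    have "comb ?Q a = comb (indeps U N) (\<lambda>S. if card (inactive U N S) = k then a S else 0)"
      unfolding comb_def by (intro sum.mono_neutral_cong_left) (auto simp: finite_indeps)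
    then have "u \<in> generated_alg N U" unfolding generated_alg_eq u by auto
    moreover have "homogeneous k (comb ?Q a)"
      unfolding comb_def
    proof (rule homogeneous_sum)
      fix S assume "S \<in> ?Q"
      then have "homogeneous k (basis_elem S)" using homogeneous_basis_elem[of S] by simp
      then show "homogeneous k (cconst (a S) * basis_elem S)"
        unfolding homogeneous_def by (auto simp: in_keys_iff lookup_cconst_mult)
    qed
    ultimately show "u \<in> generated_alg N U \<inter> Phi_comp N k"
      unfolding Phi_comp_def using comb_closed u by blast
  }
qed

end

section \<open>The two dimension formulas\<close>

theorem theorem3:
  fixes scale :: "complex \<Rightarrow> 'e::ab_group_add \<Rightarrow> 'e"
    and N n :: nat
    and v :: "nat \<Rightarrow> 'e"
  assumes "vector_space scale"
    and "vector_space.dim scale (UNIV :: 'e set) = n"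
    and "module.span scale (v ` {1..N}) = UNIV"
  shows "ring.dimension (Phi N) (ind scale N v) (Phi_scalars N) (C_alg scale N v) \<and>
    (\<forall>k. ring.dimension (Phi N)
       (card {S. indep_subset scale N v S \<and> int k = int N - int (card S) - int (act scale N v S)})
       (Phi_scalars N) (C_comp scale N v k))"
proof -
  let ?U = "coord_space scale v"
  interpret coordinates N ?U
    by (rule coordinates.intro[OF function_space_coord_space[OF assms(1)]])
  have "P_space scale N v = {\<Sum>i = 1..N. cconst (x i) * phi i | x. x \<in> ?U}"
    by (auto simp: P_space_def p_star_def coord_space_def)
  then have alg: "C_alg scale N v = generated_alg N ?U"
    by (simp add: C_alg_def generated_alg_def)
  have indeps: "{S. indep_subset scale N v S} = indeps ?U N"
    using indep_subset_iff_indeps[OF assms(1)] by blast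
  have "ring.dimension (Phi N) (ind scale N v) (Phi_scalars N) (C_alg scale N v)"
    unfolding ind_def indeps alg generated_alg_eq by (rule dimension_span_basis_elem) simp
  moreover have "ring.dimension (Phi N)
      (card {S. indep_subset scale N v S \<and> int k = int N - int (card S) - int (act scale N v S)})
      (Phi_scalars N) (C_comp scale N v k)" for k
  proof -
    \<comment> \<open>By \<open>card_inactive\<close> the integer on the right is the number of
      inactive indices, which is the degree of the basis element of \<open>S\<close>.\<close>
    have "{S. indep_subset scale N v S \<and> int k = int N - int (card S) - int (act scale N v S)} =
        {S \<in> indeps ?U N. card (inactive ?U N S) = k}"
      using card_inactive[OF assms(1), of N v] indep_subset_iff_indeps[OF assms(1), of N v]
      by (metis (no_types, lifting) of_nat_eq_iff)
    then show ?thesis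
      unfolding C_comp_def alg generated_alg_Phi_comp
      using dimension_span_basis_elem[of "{S \<in> indeps ?U N. card (inactive ?U N S) = k}"] by simp
  qed
  ultimately show ?thesis by blast
qed

end
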